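(* Let $L:\mathcal U\to\mathbb R$ be a conic pseudo-Finslerian metric on $M$, $\mathcal L=\tfrac12L$, and let $\phi:M\to\mathbb R$ be smooth. Let $\gamma$ be a motion of the conservative conic pseudo-Finslerian mechanical system $\mathcal M=(M,\mathcal L,-\nabla^v\phi)$ and let $V\in\mathfrak X(M)$ be an $L$-Killing vector field such that $w_\gamma(V)=g_{\gamma'}(D^{\gamma'}_\gamma\gamma',V\circ\gamma)=0$ along $\gamma$. Then $\omega_\gamma(V)=g_{\gamma'}(\gamma',V\circ\gamma)$ is constant along $\gamma$, and $\omega_\gamma(\nabla^{\gamma'}_{\gamma'}V)=g_{\gamma'}(\gamma',\nabla^{\gamma'}_{\gamma'}V)=0$ along $\gamma$.
   Context: Let $M$ be a smooth manifold, $\pi:TM\to M$ the projection, and $\mathcal U\subset TM\setminus 0$ an open set invariant under positive scalar multiplication. A conic pseudo-Finslerian metric is a smooth function $L:\mathcal U\to\mathbb R$ with $L(\lambda v)=\lambda^2L(v)$ for $\lambda>0$ whose fundamental tensor $g_v(u,w)=\tfrac12\frac{\partial^2}{\partial t\partial s}\big|_{t=s=0}L(v+tu+sw)$, $u,w\in T_{\pi(v)}M$, is nondegenerate for every $v\in\mathcal U$. An anisotropic vector field is a smooth map $X:\mathcal U\to TM$ with $X(v)\in T_{\pi(v)}M$. The anisotropic gradient of a smooth $f:M\to\mathbb R$ is the anisotropic vector field $v\mapsto\nabla^vf$ defined by $g_v(\nabla^vf,w)=df_{\pi(v)}(w)$ for all $w\in T_{\pi(v)}M$. An anisotropic linear connection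 is a map $(v,X,Y)\in\mathcal U\times\mathfrak X(M)\times\mathfrak X(M)\mapsto\nabla^v_XY\in T_{\pi(v)}M$, with $v\mapsto \nabla^v_XY$ an anisotropic vector field, such that for each local vector field $V$ with values in $\mathcal U$, $\nabla^V$ is a linear connection on the domain of $V$. The Chern connection of $L$ is the unique anisotropic linear connection that is torsion-free ($\nabla^v_XY-\nabla^v_YX=[X,Y]$) and metric-compatible: $Xg_V(Y,Z)=g_V(\nabla^V_XY,Z)+g_V(Y,\nabla^V_XZ)+2C_V(Y,Z,\nabla^V_XV)$, where $C_v(u_1,u_2,u_3)=\tfrac12\frac{d}{dt}\big|_{t=0}g_{v+tu_1}(u_2,u_3)$. In coordinates put $\nabla^v_{\partial_i}\partial_j=\sum_k\Gamma^k_{ij}(v)\partial_k$. For a smooth curve $\gamma$ with $\gamma'\in\mathcal U$ ($\mathcal U$-admissible) and a vector field $X=\sum_kx_k\,\partial_k\circ\gamma$ along $\gamma$, $D^{\gamma'}_\gamma X=\sum_k\{x_k'+\sum_{ij}\Gamma^k_{ij}(\gamma')\gamma_i'x_j\}\partial_k$; for $V\in\mathfrak X(M)$, $\nabla^{\gamma'}_{\gamma'}V=D^{\gamma'}_\gamma(V\circ\gamma)$. A motion of the conservative system $(M,\tfrac12L,-\nabla^v\phi)$ with potential $\phi$ is a $\mathcal U$-admissible smooth curve satisfying $D^{\gamma'}_\gamma\gamma'=-\nabla^{\gamma'}\phi$. A vector field $V$ is $L$-Killing if its flow $\varphi_s$ acts by local $L$-isometries, i.e. $d\varphi_s$ preserves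 $\mathcal U$ and $L(d\varphi_s(v))=L(v)$ wherever defined. For a vector field $X$ along $\gamma$ put $\omega_\gamma(X)=g_{\gamma'}(\gamma',X)$ (momentum) and $w_\gamma(X)=g_{\gamma'}(D^{\gamma'}_\gamma\gamma',X)$ (work). *)

theory Defs
  imports "HOL-Analysis.Analysis"
begin

section \<open>Smooth maps between normed spaces\<close>

text \<open>These two notions are meant for open \<open>S\<close>.\<close>

fun higher_differentiable_on ::
  "'a::real_normed_vector set \<Rightarrow> ('a \<Rightarrow> 'b::real_normed_vector) \<Rightarrow> nat \<Rightarrow> bool" where
  "higher_differentiable_on S f 0 \<longleftrightarrow> continuous_on S f"
| "higher_differentiable_on S f (Suc n) \<longleftrightarrow>
     (\<forall>x\<in>S. f differentiable (at x)) \<and>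
     (\<forall>v. higher_differentiable_on S (\<lambda>x. frechet_derivative f (at x) v) n)"

definition smooth_on ::
  "'a::real_normed_vector set \<Rightarrow> ('a \<Rightarrow> 'b::real_normed_vector) \<Rightarrow> bool" where
  "smooth_on S f \<longleftrightarrow> (\<forall>n. higher_differentiable_on S f n)"


section \<open>Smooth manifolds\<close>

text \<open>
  The manifold \<open>M\<close> is a type \<open>'m\<close> (Hausdorff and second countable, by its sort in the definition
  of \<open>smooth_atlas\<close>) together with an atlas \<open>A\<close> of charts with values in a Euclidean space \<open>'e\<close>.
  A chart is its domain together with a map that is only meaningful on that domain.
\<close>

type_synonym ('m, 'e) chart = "'m set \<times> ('m \<Rightarrow> 'e)"

abbreviation cdom :: "('m, 'e) chart \<Rightarrow> 'm set" where "cdom c \<equiv> fst c"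
abbreviation cmap :: "('m, 'e) chart \<Rightarrow> 'm \<Rightarrow> 'e" where "cmap c \<equiv> snd c"

definition cinv :: "('m, 'e) chart \<Rightarrow> 'e \<Rightarrow> 'm" where
  "cinv c = inv_into (cdom c) (cmap c)"

definition smooth_atlas ::
  "('m::{t2_space, second_countable_topology}, 'e::euclidean_space) chart set \<Rightarrow> bool" where
  "smooth_atlas A \<longleftrightarrow>
     (\<Union>c\<in>A. cdom c) = UNIV \<and>
     (\<forall>c\<in>A. open (cdom c) \<and> open (cmap c ` cdom c) \<and>
        homeomorphism (cdom c) (cmap c ` cdom c) (cmap c) (cinv c)) \<and>
     (\<forall>c\<in>A. \<forall>d\<in>A. smooth_on (cmap c ` (cdom c \<inter> cdom d)) (cmap d \<circ> cinv c))"

definition chart_at :: "('m, 'e) chart set \<Rightarrow> 'm \<Rightarrow> ('m, 'e) chart" where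
  "chart_at A p = (SOME c. c \<in> A \<and> p \<in> cdom c)"


section \<open>Tangent vectors\<close>

text \<open>
  A tangent vector at \<open>p\<close> is the family of its component vectors \<open>\<xi> c\<close>, one for each chart \<open>c\<close>
  around \<open>p\<close>, subject to the usual transformation law (and \<open>0\<close> at all other charts, so that the
  family is determined by its components).  A point of \<open>TM\<close> is a pair \<open>(p, \<xi>)\<close>, so \<open>fst\<close> is the
  projection \<open>\<pi>\<close>.  The vector space operations of \<open>T\<^sub>pM\<close> are the pointwise ones.
\<close>

type_synonym ('m, 'e) tvec = "('m, 'e) chart \<Rightarrow> 'e"

definition transition_deriv ::
  "('m, 'e::real_normed_vector) chart \<Rightarrow> ('m, 'e) chart \<Rightarrow> 'm \<Rightarrow> 'e \<Rightarrow> 'e" where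
  "transition_deriv c d p = frechet_derivative (cmap d \<circ> cinv c) (at (cmap c p))"

definition tangent_space ::
  "('m, 'e::real_normed_vector) chart set \<Rightarrow> 'm \<Rightarrow> ('m, 'e) tvec set" where
  "tangent_space A p =
     {\<xi>. (\<forall>c. \<not> (c \<in> A \<and> p \<in> cdom c) \<longrightarrow> \<xi> c = 0) \<and>
         (\<forall>c\<in>A. \<forall>d\<in>A. p \<in> cdom c \<and> p \<in> cdom d \<longrightarrow> \<xi> d = transition_deriv c d p (\<xi> c))}"

definition tangent_bundle ::
  "('m, 'e::real_normed_vector) chart set \<Rightarrow> ('m \<times> ('m, 'e) tvec) set" where
  "tangent_bundle A = (SIGMA p:UNIV. tangent_space A p)"

definition tzero :: "('m, 'e::real_normed_vector) tvec" where
  "tzero = (\<lambda>c. 0)"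

definition tadd ::
  "('m, 'e::real_normed_vector) tvec \<Rightarrow> ('m, 'e) tvec \<Rightarrow> ('m, 'e) tvec" (infixl "+\<^sub>T" 65) where
  "\<xi> +\<^sub>T \<eta> = (\<lambda>c. \<xi> c + \<eta> c)"

definition tscale ::
  "real \<Rightarrow> ('m, 'e::real_normed_vector) tvec \<Rightarrow> ('m, 'e) tvec" (infixr "*\<^sub>T" 75) where
  "r *\<^sub>T \<xi> = (\<lambda>c. r *\<^sub>R \<xi> c)"

definition tminus ::
  "('m, 'e::real_normed_vector) tvec \<Rightarrow> ('m, 'e) tvec \<Rightarrow> ('m, 'e) tvec" (infixl "-\<^sub>T" 65) where
  "\<xi> -\<^sub>T \<eta> = (\<lambda>c. \<xi> c - \<eta> c)"

text \<open>The tangent vector at \<open>p\<close> whose component vector in the chart \<open>c\<close> is \<open>y\<close>.\<close>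

definition tvec_of ::
  "('m, 'e::real_normed_vector) chart set \<Rightarrow> ('m, 'e) chart \<Rightarrow> 'm \<Rightarrow> 'e \<Rightarrow> ('m, 'e) tvec" where
  "tvec_of A c p y = (\<lambda>d. if d \<in> A \<and> p \<in> cdom d then transition_deriv c d p y else 0)"

text \<open>The chart of \<open>TM\<close> induced by \<open>c\<close>, and its inverse.\<close>

definition tchart ::
  "('m, 'e) chart \<Rightarrow> 'm \<times> ('m, 'e) tvec \<Rightarrow> 'e \<times> 'e" where
  "tchart c v = (cmap c (fst v), snd v c)"

definition tchart_inv ::
  "('m, 'e::real_normed_vector) chart set \<Rightarrow> ('m, 'e) chart \<Rightarrow> 'e \<times> 'e \<Rightarrow> 'm \<times> ('m, 'e) tvec"
  where "tchart_inv A c z = (cinv c (fst z), tvec_of A c (cinv c (fst z)) (snd z))"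

definition open_in_TM ::
  "('m, 'e::real_normed_vector) chart set \<Rightarrow> ('m \<times> ('m, 'e) tvec) set \<Rightarrow> bool" where
  "open_in_TM A U \<longleftrightarrow> U \<subseteq> tangent_bundle A \<and>
     (\<forall>c\<in>A. open (tchart c ` {v \<in> U. fst v \<in> cdom c}))"


section \<open>Smooth functions, vector fields, anisotropic vector fields\<close>

definition smooth_fun_on ::
  "('m, 'e::real_normed_vector) chart set \<Rightarrow> 'm set \<Rightarrow> ('m \<Rightarrow> real) \<Rightarrow> bool" where
  "smooth_fun_on A W f \<longleftrightarrow> (\<forall>c\<in>A. smooth_on (cmap c ` (W \<inter> cdom c)) (\<lambda>x. f (cinv c x)))"

definition tdiff ::
  "('m, 'e::real_normed_vector) chart set \<Rightarrow> ('m \<Rightarrow> real) \<Rightarrow> 'm \<Rightarrow> ('m, 'e) tvec \<Rightarrow> real" where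
  "tdiff A f p \<xi> = (let c = chart_at A p in
     frechet_derivative (\<lambda>x. f (cinv c x)) (at (cmap c p)) (\<xi> c))"

text \<open>Vector fields on an open set \<open>W\<close> are represented by functions whose values off \<open>W\<close> are
  irrelevant.\<close>

definition vector_field_on ::
  "('m, 'e::real_normed_vector) chart set \<Rightarrow> 'm set \<Rightarrow> ('m \<Rightarrow> ('m, 'e) tvec) \<Rightarrow> bool" where
  "vector_field_on A W X \<longleftrightarrow> (\<forall>p\<in>W. X p \<in> tangent_space A p) \<and>
     (\<forall>c\<in>A. smooth_on (cmap c ` (W \<inter> cdom c)) (\<lambda>x. X (cinv c x) c))"

definition lie_bracket ::
  "('m, 'e::real_normed_vector) chart set \<Rightarrow>
   ('m \<Rightarrow> ('m, 'e) tvec) \<Rightarrow> ('m \<Rightarrow> ('m, 'e) tvec) \<Rightarrow> 'm \<Rightarrow> ('m, 'e) tvec" where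
  "lie_bracket A X Y p = (\<lambda>c. if c \<in> A \<and> p \<in> cdom c
     then frechet_derivative (\<lambda>x. Y (cinv c x) c) (at (cmap c p)) (X p c)
        - frechet_derivative (\<lambda>x. X (cinv c x) c) (at (cmap c p)) (Y p c)
     else 0)"

definition smooth_fun_on_TM ::
  "('m, 'e::real_normed_vector) chart set \<Rightarrow> ('m \<times> ('m, 'e) tvec) set \<Rightarrow>
   ('m \<times> ('m, 'e) tvec \<Rightarrow> real) \<Rightarrow> bool" where
  "smooth_fun_on_TM A U F \<longleftrightarrow>
     (\<forall>c\<in>A. smooth_on (tchart c ` {v \<in> U. fst v \<in> cdom c}) (\<lambda>z. F (tchart_inv A c z)))"

definition aniso_vector_field ::
  "('m, 'e::real_normed_vector) chart set \<Rightarrow> ('m \<times> ('m, 'e) tvec) set \<Rightarrow>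
   ('m \<times> ('m, 'e) tvec \<Rightarrow> ('m, 'e) tvec) \<Rightarrow> bool" where
  "aniso_vector_field A U X \<longleftrightarrow> (\<forall>v\<in>U. X v \<in> tangent_space A (fst v)) \<and>
     (\<forall>c\<in>A. smooth_on (tchart c ` {v \<in> U. fst v \<in> cdom c}) (\<lambda>z. X (tchart_inv A c z) c))"


section \<open>Conic pseudo-Finslerian metrics\<close>

definition fund_tensor ::
  "('m \<times> ('m, 'e::real_normed_vector) tvec \<Rightarrow> real) \<Rightarrow> 'm \<times> ('m, 'e) tvec \<Rightarrow>
   ('m, 'e) tvec \<Rightarrow> ('m, 'e) tvec \<Rightarrow> real" where
  "fund_tensor L v u w =
     1/2 * deriv (\<lambda>t. deriv (\<lambda>s. L (fst v, snd v +\<^sub>T t *\<^sub>T u +\<^sub>T s *\<^sub>T w)) 0) 0"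

definition cartan_tensor ::
  "('m \<times> ('m, 'e::real_normed_vector) tvec \<Rightarrow> real) \<Rightarrow> 'm \<times> ('m, 'e) tvec \<Rightarrow>
   ('m, 'e) tvec \<Rightarrow> ('m, 'e) tvec \<Rightarrow> ('m, 'e) tvec \<Rightarrow> real" where
  "cartan_tensor L v u1 u2 u3 =
     1/2 * deriv (\<lambda>t. fund_tensor L (fst v, snd v +\<^sub>T t *\<^sub>T u1) u2 u3) 0"

definition conic_domain ::
  "('m, 'e::real_normed_vector) chart set \<Rightarrow> ('m \<times> ('m, 'e) tvec) set \<Rightarrow> bool" where
  "conic_domain A U \<longleftrightarrow> open_in_TM A U \<and> (\<forall>v\<in>U. snd v \<noteq> tzero) \<and>
     (\<forall>v\<in>U. \<forall>r>0. (fst v, r *\<^sub>T snd v) \<in> U)"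

definition conic_pseudo_finsler ::
  "('m, 'e::real_normed_vector) chart set \<Rightarrow> ('m \<times> ('m, 'e) tvec) set \<Rightarrow>
   ('m \<times> ('m, 'e) tvec \<Rightarrow> real) \<Rightarrow> bool" where
  "conic_pseudo_finsler A U L \<longleftrightarrow> conic_domain A U \<and> smooth_fun_on_TM A U L \<and>
     (\<forall>v\<in>U. \<forall>r>0. L (fst v, r *\<^sub>T snd v) = r\<^sup>2 * L v) \<and>
     (\<forall>v\<in>U. \<forall>u \<in> tangent_space A (fst v).
        (\<forall>w \<in> tangent_space A (fst v). fund_tensor L v u w = 0) \<longrightarrow> u = tzero)"

definition aniso_gradient ::
  "('m, 'e::real_normed_vector) chart set \<Rightarrow> ('m \<times> ('m, 'e) tvec \<Rightarrow> real) \<Rightarrow> ('m \<Rightarrow> real) \<Rightarrow>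
   'm \<times> ('m, 'e) tvec \<Rightarrow> ('m, 'e) tvec" where
  "aniso_gradient A L f v = (THE u. u \<in> tangent_space A (fst v) \<and>
     (\<forall>w \<in> tangent_space A (fst v). fund_tensor L v u w = tdiff A f (fst v) w))"


section \<open>Anisotropic connections\<close>

text \<open>
  A linear connection on the open set \<open>W\<close>.  The second clause says that the operator depends only
  on the restrictions of its arguments to \<open>W\<close>, i.e. is an operator on the vector fields of \<open>W\<close>.
\<close>

definition linear_connection_on ::
  "('m, 'e::real_normed_vector) chart set \<Rightarrow> 'm set \<Rightarrow>
   (('m \<Rightarrow> ('m, 'e) tvec) \<Rightarrow> ('m \<Rightarrow> ('m, 'e) tvec) \<Rightarrow> 'm \<Rightarrow> ('m, 'e) tvec) \<Rightarrow> bool" where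
  "linear_connection_on A W D \<longleftrightarrow>
     (\<forall>X Y. vector_field_on A W X \<and> vector_field_on A W Y \<longrightarrow> vector_field_on A W (D X Y)) \<and>
     (\<forall>X X' Y Y'. vector_field_on A W X \<and> vector_field_on A W Y \<and>
        (\<forall>p\<in>W. X p = X' p \<and> Y p = Y' p) \<longrightarrow> (\<forall>p\<in>W. D X Y p = D X' Y' p)) \<and>
     (\<forall>X X' Y. vector_field_on A W X \<and> vector_field_on A W X' \<and> vector_field_on A W Y \<longrightarrow>
        (\<forall>p\<in>W. D (\<lambda>q. X q +\<^sub>T X' q) Y p = D X Y p +\<^sub>T D X' Y p)) \<and>
     (\<forall>f X Y. smooth_fun_on A W f \<and> vector_field_on A W X \<and> vector_field_on A W Y \<longrightarrow>
        (\<forall>p\<in>W. D (\<lambda>q. f q *\<^sub>T X q) Y p = f p *\<^sub>T D X Y p)) \<and>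
     (\<forall>X Y Y'. vector_field_on A W X \<and> vector_field_on A W Y \<and> vector_field_on A W Y' \<longrightarrow>
        (\<forall>p\<in>W. D X (\<lambda>q. Y q +\<^sub>T Y' q) p = D X Y p +\<^sub>T D X Y' p)) \<and>
     (\<forall>f X Y. smooth_fun_on A W f \<and> vector_field_on A W X \<and> vector_field_on A W Y \<longrightarrow>
        (\<forall>p\<in>W. D X (\<lambda>q. f q *\<^sub>T Y q) p = tdiff A f p (X p) *\<^sub>T Y p +\<^sub>T f p *\<^sub>T D X Y p))"

text \<open>
  The connection may be applied to vector fields \<open>X\<close>, \<open>Y\<close> that are defined on any open
  neighbourhood \<open>W\<close> of the base point of \<open>v\<close>; \<open>W = UNIV\<close> gives the operation on global
  vector fields.  A connection given on global fields only is local and therefore extends uniquely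
  to this setting, and the extension is what gives a meaning to \<open>\<nabla>\<^sup>V\<close> on the domain of a local
  field \<open>V\<close>, to \<open>\<nabla>\<^sup>V\<^sub>X V\<close> and to \<open>\<nabla>\<^sup>v\<close> of coordinate fields.
\<close>

type_synonym ('m, 'e) aniso_conn =
  "'m \<times> ('m, 'e) tvec \<Rightarrow> ('m \<Rightarrow> ('m, 'e) tvec) \<Rightarrow> ('m \<Rightarrow> ('m, 'e) tvec) \<Rightarrow> ('m, 'e) tvec"

definition aniso_connection ::
  "('m::topological_space, 'e::real_normed_vector) chart set \<Rightarrow> ('m \<times> ('m, 'e) tvec) set \<Rightarrow>
   ('m, 'e) aniso_conn \<Rightarrow> bool" where
  "aniso_connection A U nabla \<longleftrightarrow>
     (\<forall>W X Y. open W \<and> vector_field_on A W X \<and> vector_field_on A W Y \<longrightarrow>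
        aniso_vector_field A {v \<in> U. fst v \<in> W} (\<lambda>v. nabla v X Y)) \<and>
     (\<forall>W V. open W \<and> vector_field_on A W V \<and> (\<forall>p\<in>W. (p, V p) \<in> U) \<longrightarrow>
        linear_connection_on A W (\<lambda>X Y p. nabla (p, V p) X Y))"

definition chern_connection ::
  "('m::topological_space, 'e::real_normed_vector) chart set \<Rightarrow> ('m \<times> ('m, 'e) tvec) set \<Rightarrow>
   ('m \<times> ('m, 'e) tvec \<Rightarrow> real) \<Rightarrow> ('m, 'e) aniso_conn \<Rightarrow> bool" where
  "chern_connection A U L nabla \<longleftrightarrow> aniso_connection A U nabla \<and>
     (\<forall>W X Y v. open W \<and> vector_field_on A W X \<and> vector_field_on A W Y \<and> v \<in> U \<and> fst v \<in> W \<longrightarrow>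
        nabla v X Y -\<^sub>T nabla v Y X = lie_bracket A X Y (fst v)) \<and>
     (\<forall>W V X Y Z. open W \<and> vector_field_on A W V \<and> (\<forall>p\<in>W. (p, V p) \<in> U) \<and>
        vector_field_on A W X \<and> vector_field_on A W Y \<and> vector_field_on A W Z \<longrightarrow>
        (\<forall>p\<in>W. tdiff A (\<lambda>q. fund_tensor L (q, V q) (Y q) (Z q)) p (X p) =
             fund_tensor L (p, V p) (nabla (p, V p) X Y) (Z p)
           + fund_tensor L (p, V p) (Y p) (nabla (p, V p) X Z)
           + 2 * cartan_tensor L (p, V p) (Y p) (Z p) (nabla (p, V p) X V)))"

text \<open>The coordinate field \<open>\<partial>\<^sub>i\<close> of a chart; indices range over \<open>Basis\<close>.\<close>

definition coord_field ::
  "('m, 'e::real_normed_vector) chart set \<Rightarrow> ('m, 'e) chart \<Rightarrow> 'e \<Rightarrow> 'm \<Rightarrow> ('m, 'e) tvec" where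
  "coord_field A c i p = tvec_of A c p i"

definition christoffel ::
  "('m, 'e::euclidean_space) chart set \<Rightarrow> ('m, 'e) aniso_conn \<Rightarrow> ('m, 'e) chart \<Rightarrow>
   'm \<times> ('m, 'e) tvec \<Rightarrow> 'e \<Rightarrow> 'e \<Rightarrow> 'e \<Rightarrow> real" where
  "christoffel A nabla c v i j k = nabla v (coord_field A c i) (coord_field A c j) c \<bullet> k"


section \<open>Curves\<close>

text \<open>
  Curves are parametrised by an interval \<open>I\<close> which may contain end points; smoothness there means
  that the curve extends smoothly, and derivatives there are one-sided.
\<close>

definition smooth_curve ::
  "('m, 'e::real_normed_vector) chart set \<Rightarrow> real set \<Rightarrow> (real \<Rightarrow> 'm) \<Rightarrow> bool" where
  "smooth_curve A I \<gamma> \<longleftrightarrow> is_interval I \<and> interior I \<noteq> {} \<and>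
     (\<forall>t\<in>I. \<exists>c\<in>A. \<exists>\<epsilon>>0. \<exists>h. smooth_on (ball t \<epsilon>) h \<and>
        (\<forall>s \<in> I \<inter> ball t \<epsilon>. \<gamma> s \<in> cdom c \<and> cmap c (\<gamma> s) = h s))"

definition velocity ::
  "('m, 'e::real_normed_vector) chart set \<Rightarrow> real set \<Rightarrow> (real \<Rightarrow> 'm) \<Rightarrow> real \<Rightarrow> ('m, 'e) tvec"
  where "velocity A I \<gamma> t = (\<lambda>c. if c \<in> A \<and> \<gamma> t \<in> cdom c
     then vector_derivative (\<lambda>s. cmap c (\<gamma> s)) (at t within I) else 0)"

definition lift ::
  "('m, 'e::real_normed_vector) chart set \<Rightarrow> real set \<Rightarrow> (real \<Rightarrow> 'm) \<Rightarrow> real \<Rightarrow>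
   'm \<times> ('m, 'e) tvec" where
  "lift A I \<gamma> t = (\<gamma> t, velocity A I \<gamma> t)"

definition admissible_curve ::
  "('m, 'e::real_normed_vector) chart set \<Rightarrow> ('m \<times> ('m, 'e) tvec) set \<Rightarrow> real set \<Rightarrow>
   (real \<Rightarrow> 'm) \<Rightarrow> bool" where
  "admissible_curve A U I \<gamma> \<longleftrightarrow> smooth_curve A I \<gamma> \<and> (\<forall>t\<in>I. lift A I \<gamma> t \<in> U)"

text \<open>The covariant derivative along \<open>\<gamma>\<close> with reference vector \<open>\<gamma>'\<close>, by its coordinate formula
  in some chart around \<open>\<gamma> t\<close> (the resulting tangent vector does not depend on the chart).\<close>

definition cov_deriv ::
  "('m, 'e::euclidean_space) chart set \<Rightarrow> ('m, 'e) aniso_conn \<Rightarrow> real set \<Rightarrow> (real \<Rightarrow> 'm) \<Rightarrow>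
   (real \<Rightarrow> ('m, 'e) tvec) \<Rightarrow> real \<Rightarrow> ('m, 'e) tvec" where
  "cov_deriv A nabla I \<gamma> X t = (let c = chart_at A (\<gamma> t) in
     tvec_of A c (\<gamma> t)
       (\<Sum>k\<in>Basis. (vector_derivative (\<lambda>s. X s c) (at t within I) \<bullet> k
          + (\<Sum>i\<in>Basis. \<Sum>j\<in>Basis. christoffel A nabla c (lift A I \<gamma> t) i j k
               * (velocity A I \<gamma> t c \<bullet> i) * (X t c \<bullet> j))) *\<^sub>R k))"

text \<open>Motions of the mechanical system with kinetic Lagrangian \<open>L/2\<close>, where \<open>nabla\<close> is the Chern
  connection of \<open>L\<close>, and force field \<open>F\<close>.\<close>

definition motion ::
  "('m, 'e::euclidean_space) chart set \<Rightarrow> ('m \<times> ('m, 'e) tvec) set \<Rightarrow> ('m, 'e) aniso_conn \<Rightarrow>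
   ('m \<times> ('m, 'e) tvec \<Rightarrow> ('m, 'e) tvec) \<Rightarrow> real set \<Rightarrow> (real \<Rightarrow> 'm) \<Rightarrow> bool" where
  "motion A U nabla F I \<gamma> \<longleftrightarrow> admissible_curve A U I \<gamma> \<and>
     (\<forall>t\<in>I. cov_deriv A nabla I \<gamma> (velocity A I \<gamma>) t = F (lift A I \<gamma> t))"

definition conservative_force ::
  "('m, 'e::real_normed_vector) chart set \<Rightarrow> ('m \<times> ('m, 'e) tvec \<Rightarrow> real) \<Rightarrow> ('m \<Rightarrow> real) \<Rightarrow>
   'm \<times> ('m, 'e) tvec \<Rightarrow> ('m, 'e) tvec" where
  "conservative_force A L \<phi> v = (- 1) *\<^sub>T aniso_gradient A L \<phi> v"

definition momentum ::
  "('m, 'e::real_normed_vector) chart set \<Rightarrow> ('m \<times> ('m, 'e) tvec \<Rightarrow> real) \<Rightarrow> real set \<Rightarrow>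
   (real \<Rightarrow> 'm) \<Rightarrow> (real \<Rightarrow> ('m, 'e) tvec) \<Rightarrow> real \<Rightarrow> real" where
  "momentum A L I \<gamma> X t = fund_tensor L (lift A I \<gamma> t) (velocity A I \<gamma> t) (X t)"

definition work ::
  "('m, 'e::euclidean_space) chart set \<Rightarrow> ('m \<times> ('m, 'e) tvec \<Rightarrow> real) \<Rightarrow> ('m, 'e) aniso_conn \<Rightarrow>
   real set \<Rightarrow> (real \<Rightarrow> 'm) \<Rightarrow> (real \<Rightarrow> ('m, 'e) tvec) \<Rightarrow> real \<Rightarrow> real" where
  "work A L nabla I \<gamma> X t =
     fund_tensor L (lift A I \<gamma> t) (cov_deriv A nabla I \<gamma> (velocity A I \<gamma>) t) (X t)"


section \<open>Flows and Killing vector fields\<close>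

definition integral_curve ::
  "('m, 'e::real_normed_vector) chart set \<Rightarrow> ('m \<Rightarrow> ('m, 'e) tvec) \<Rightarrow> real set \<Rightarrow>
   (real \<Rightarrow> 'm) \<Rightarrow> bool" where
  "integral_curve A V I \<sigma> \<longleftrightarrow> smooth_curve A I \<sigma> \<and> (\<forall>t\<in>I. velocity A I \<sigma> t = V (\<sigma> t))"

text \<open>
  \<open>E\<close> is the domain (flow domain) and \<open>\<Phi>\<close> the map of the maximal smooth flow of \<open>V\<close>.  Every smooth
  vector field has one, with \<open>E\<close> and \<open>\<Phi>\<close> on \<open>E\<close> uniquely determined.  Openness of the coordinate
  domains in the fifth conjunct expresses the continuity of \<open>\<Phi>\<close> on \<open>E\<close>.
\<close>

definition flow_of ::
  "('m::topological_space, 'e::real_normed_vector) chart set \<Rightarrow> ('m \<Rightarrow> ('m, 'e) tvec) \<Rightarrow>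
   (real \<times> 'm) set \<Rightarrow> (real \<Rightarrow> 'm \<Rightarrow> 'm) \<Rightarrow> bool" where
  "flow_of A V E \<Phi> \<longleftrightarrow>
     open E \<and>
     (\<forall>p. (0, p) \<in> E \<and> \<Phi> 0 p = p) \<and>
     (\<forall>p. integral_curve A V {s. (s, p) \<in> E} (\<lambda>s. \<Phi> s p)) \<and>
     (\<forall>p J \<sigma>. open J \<and> 0 \<in> J \<and> integral_curve A V J \<sigma> \<and> \<sigma> 0 = p \<longrightarrow> J \<subseteq> {s. (s, p) \<in> E}) \<and>
     (\<forall>c\<in>A. \<forall>d\<in>A.
        let S = {(s, x). x \<in> cmap c ` cdom c \<and> (s, cinv c x) \<in> E \<and> \<Phi> s (cinv c x) \<in> cdom d}
        in open S \<and> smooth_on S (\<lambda>(s, x). cmap d (\<Phi> s (cinv c x))))"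

text \<open>The differential at \<open>p\<close> of a map \<open>F\<close> from (an open subset of) \<open>M\<close> to \<open>M\<close>.\<close>

definition tmap ::
  "('m, 'e::real_normed_vector) chart set \<Rightarrow> ('m \<Rightarrow> 'm) \<Rightarrow> 'm \<Rightarrow> ('m, 'e) tvec \<Rightarrow> ('m, 'e) tvec"
  where "tmap A F p \<xi> = (let c = chart_at A p in
     (\<lambda>d. if d \<in> A \<and> F p \<in> cdom d
        then frechet_derivative (\<lambda>x. cmap d (F (cinv c x))) (at (cmap c p)) (\<xi> c) else 0))"

definition killing ::
  "('m::topological_space, 'e::real_normed_vector) chart set \<Rightarrow> ('m \<times> ('m, 'e) tvec) set \<Rightarrow>
   ('m \<times> ('m, 'e) tvec \<Rightarrow> real) \<Rightarrow> ('m \<Rightarrow> ('m, 'e) tvec) \<Rightarrow> bool" where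
  "killing A U L V \<longleftrightarrow> vector_field_on A UNIV V \<and>
     (\<exists>E \<Phi>. flow_of A V E \<Phi> \<and>
        (\<forall>s p \<xi>. (s, p) \<in> E \<and> (p, \<xi>) \<in> U \<longrightarrow>
           (\<Phi> s p, tmap A (\<Phi> s) p \<xi>) \<in> U \<and> L (\<Phi> s p, tmap A (\<Phi> s) p \<xi>) = L (p, \<xi>)))"

end

theory Submission
  imports Defs
begin

text \<open>
  In a chart write \<open>l (x, y)\<close> for \<open>L\<close>, and \<open>x\<close>, \<open>y = x'\<close> for the curve and its velocity.  Homogeneity
  gives \<open>g\<^sub>y(y, w) = 1/2 \<partial>\<^sub>y l w\<close> and \<open>C\<^sub>y(y, \<cdot>, \<cdot>) = 0\<close>, so that metric compatibility, applied to
  constant coordinate fields with reference field \<open>y\<close>, becomes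
  \<open>\<partial>\<^sub>x (\<partial>\<^sub>y l d) a = \<partial>\<^sub>y (\<partial>\<^sub>y l d) (\<Gamma>(a, y)) + \<partial>\<^sub>y l (\<Gamma>(a, d))\<close>; for \<open>d = y\<close> this says
  \<open>\<partial>\<^sub>x l a = \<partial>\<^sub>y l (\<Gamma>(a, y))\<close>.  Together with the symmetry of \<open>\<Gamma>\<close> it follows that
  \<open>2 g(D\<gamma>', w) = (\<partial>\<^sub>y l)' w - \<partial>\<^sub>x l w\<close>.  Differentiating the invariance of \<open>L\<close> under the flow of \<open>V\<close>
  gives \<open>\<partial>\<^sub>x l V + \<partial>\<^sub>y l (DV y) = 0\<close>.  If the work vanishes, the derivative of the momentum
  \<open>1/2 \<partial>\<^sub>y l V\<close> is half the left-hand side of this identity, and the same holds for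
  \<open>g(\<gamma>', \<nabla>V) = 1/2 \<partial>\<^sub>y l (DV y + \<Gamma>(y, V))\<close>.
\<close>

section \<open>Calculus of smooth maps\<close>

text \<open>Because \<open>S\<close> is open, agreement on \<open>S\<close> already fixes the
  derivatives at each of its points, so the induction can pass to them.\<close>

lemma higher_differentiable_on_cong:
  assumes "open S" "\<And>x. x \<in> S \<Longrightarrow> f x = g x" "higher_differentiable_on S f n"
  shows "higher_differentiable_on S g n"
  using assms(2,3)
proof (induction n arbitrary: f g)
  case 0
  then show ?case using continuous_on_cong by fastforce
next
  case (Suc n)
  have diff: "f differentiable (at x)" if "x \<in> S" for x
    using Suc.prems(2) that by simp
  have "(g has_derivative frechet_derivative f (at x)) (at x)" if "x \<in> S" for x
    using has_derivative_transform_within_open[OF _ \<open>open S\<close> that]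
      frechet_derivative_works diff[OF that] Suc.prems(1) by blast
  moreover from this have "frechet_derivative f (at x) = frechet_derivative g (at x)"
    if "x \<in> S" for x
    using that by (simp add: frechet_derivative_at)
  ultimately show ?case
    using Suc.IH[of "\<lambda>x. frechet_derivative f (at x) v" "\<lambda>x. frechet_derivative g (at x) v" for v]
      Suc.prems(2) by (auto simp: differentiable_def)
qed

text \<open>Lets the product and chain rules reuse an undifferentiated factor at the lower order
  that the induction hypothesis asks for.\<close>

lemma higher_differentiable_on_SucD:
  "higher_differentiable_on S f (Suc n) \<Longrightarrow> higher_differentiable_on S f n"
proof (induction n arbitrary: f)
  case 0
  then show ?case
    by (auto intro!: continuous_at_imp_continuous_on differentiable_imp_continuous_within)
next
  case (Suc n)
  then show ?case
    by (metis higher_differentiable_on.simps(2))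
qed

lemma higher_differentiable_on_subset:
  "higher_differentiable_on S f n \<Longrightarrow> T \<subseteq> S \<Longrightarrow> higher_differentiable_on T f n"
  by (induction n arbitrary: f) (auto intro: continuous_on_subset)

lemma higher_differentiable_on_const: "higher_differentiable_on S (\<lambda>x. c) n"
  by (induction n arbitrary: c) auto

lemma higher_differentiable_on_add:
  assumes "open S" "higher_differentiable_on S f n" "higher_differentiable_on S g n"
  shows "higher_differentiable_on S (\<lambda>x. f x + g x) n"
  using assms(2,3)
proof (induction n arbitrary: f g)
  case 0
  then show ?case by (auto intro: continuous_intros)
next
  case (Suc n)
  have D: "((\<lambda>x. f x + g x) has_derivative
      (\<lambda>v. frechet_derivative f (at x) v + frechet_derivative g (at x) v)) (at x)" if "x \<in> S" for x
    using Suc.prems that by (auto intro!: has_derivative_add simp: frechet_derivative_works[symmetric])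
  then have E: "frechet_derivative f (at x) v + frechet_derivative g (at x) v =
      frechet_derivative (\<lambda>x. f x + g x) (at x) v" if "x \<in> S" for x v
    using fun_cong[OF frechet_derivative_at[OF D[OF that]], of v] by simp
  have "higher_differentiable_on S (\<lambda>x. frechet_derivative (\<lambda>x. f x + g x) (at x) v) n" for v
    by (rule higher_differentiable_on_cong[OF \<open>open S\<close> E Suc.IH]) (use Suc.prems in auto)
  then show ?case using D by (auto simp: differentiable_def)
qed

lemma higher_differentiable_on_sum:
  assumes "open S" "finite B" "\<And>i. i \<in> B \<Longrightarrow> higher_differentiable_on S (f i) n"
  shows "higher_differentiable_on S (\<lambda>x. \<Sum>i\<in>B. f i x) n"
  using assms(2,3)
  by (induction B rule: finite_induct)
    (auto intro: higher_differentiable_on_const higher_differentiable_on_add[OF \<open>open S\<close>])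

text \<open>By the product rule the derivative is a sum of two terms of the same bilinear shape,
  each with one factor differentiated once. Inner products and scalar multiples are the instances
  needed.\<close>

lemma higher_differentiable_on_bilinear:
  assumes B: "bounded_bilinear B" and "open S" "higher_differentiable_on S f n" "higher_differentiable_on S g n"
  shows "higher_differentiable_on S (\<lambda>x. B (f x) (g x)) n"
  using assms(3,4)
proof (induction n arbitrary: f g)
  case 0
  then show ?case by (auto intro: bounded_bilinear.continuous_on[OF B])
next
  case (Suc n)
  have D: "((\<lambda>x. B (f x) (g x)) has_derivative
      (\<lambda>v. B (f x) (frechet_derivative g (at x) v) + B (frechet_derivative f (at x) v) (g x))) (at x)"
    if "x \<in> S" for x
    using Suc.prems that by (auto intro!: bounded_bilinear.FDERIV[OF B] simp: frechet_derivative_works[symmetric])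
  then have E: "B (f x) (frechet_derivative g (at x) v) + B (frechet_derivative f (at x) v) (g x) =
      frechet_derivative (\<lambda>x. B (f x) (g x)) (at x) v" if "x \<in> S" for x v
    using fun_cong[OF frechet_derivative_at[OF D[OF that]], of v] by simp
  have "higher_differentiable_on S f n" "higher_differentiable_on S g n"
    using Suc.prems higher_differentiable_on_SucD by blast+
  then have "higher_differentiable_on S (\<lambda>x. frechet_derivative (\<lambda>x. B (f x) (g x)) (at x) v) n" for v
    by (intro higher_differentiable_on_cong[OF \<open>open S\<close> E]
        higher_differentiable_on_add[OF \<open>open S\<close>] Suc.IH)
      (use Suc.prems in auto)
  then show ?case using D by (auto simp: differentiable_def)
qed

text \<open>Replaces a derivative in a varying direction by derivatives in fixed directions, the
  only ones that \<open>higher_differentiable_on\<close> speaks about.\<close>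

lemma linear_euclidean_expansion:
  fixes f :: "'a::euclidean_space \<Rightarrow> 'b::real_vector"
  assumes "linear f"
  shows "f v = (\<Sum>i\<in>Basis. (v \<bullet> i) *\<^sub>R f i)"
proof -
  have "f v = f (\<Sum>i\<in>Basis. (v \<bullet> i) *\<^sub>R i)"
    by (simp add: euclidean_representation)
  then show ?thesis
    by (simp add: linear_sum[OF assms] linear_cmul[OF assms])
qed

text \<open>In the chain rule the derivative of \<open>f\<close> is taken in a direction that varies
  with the point. Expanding this direction over \<open>Basis\<close> leaves products of components
  of the derivative of \<open>g\<close> with compositions of lower order, so the induction runs over
  \<open>f\<close> with \<open>g\<close> fixed.\<close>

lemma higher_differentiable_on_compose:
  fixes f :: "'b::euclidean_space \<Rightarrow> 'c::real_normed_vector"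
  assumes "open S" "open T" "g ` S \<subseteq> T" "higher_differentiable_on T f n" "higher_differentiable_on S g n"
  shows "higher_differentiable_on S (\<lambda>x. f (g x)) n"
  using assms(4,5)
proof (induction n arbitrary: f)
  case 0
  then show ?case using assms(3) continuous_on_compose2 by fastforce
next
  case (Suc n)
  have df: "(f has_derivative frechet_derivative f (at (g x))) (at (g x))" if "x \<in> S" for x
    using Suc.prems(1) that assms(3) by (auto simp: frechet_derivative_works[symmetric])
  have dg: "(g has_derivative frechet_derivative g (at x)) (at x)" if "x \<in> S" for x
    using Suc.prems(2) that by (auto simp: frechet_derivative_works[symmetric])
  have D: "((\<lambda>x. f (g x)) has_derivative
      (\<lambda>v. frechet_derivative f (at (g x)) (frechet_derivative g (at x) v))) (at x)"
    if "x \<in> S" for x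
    by (rule has_derivative_compose[OF dg[OF that] df[OF that]])
  have E: "(\<Sum>i\<in>Basis. (frechet_derivative g (at x) v \<bullet> i) *\<^sub>R frechet_derivative f (at (g x)) i) =
      frechet_derivative (\<lambda>x. f (g x)) (at x) v" if "x \<in> S" for x v
    using frechet_derivative_at[OF D[OF that]]
      linear_euclidean_expansion[OF has_derivative_linear[OF df[OF that]]] by metis
  have "higher_differentiable_on S g n"
    using Suc.prems(2) higher_differentiable_on_SucD by blast
  moreover have "higher_differentiable_on S (\<lambda>x. frechet_derivative g (at x) v \<bullet> i) n" for v i
    by (rule higher_differentiable_on_bilinear[OF bounded_bilinear_inner \<open>open S\<close>])
      (use Suc.prems higher_differentiable_on_const in auto)
  ultimately have "higher_differentiable_on S (\<lambda>x. frechet_derivative (\<lambda>x. f (g x)) (at x) v) n" for v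
    using Suc.prems(1)
    by (intro higher_differentiable_on_cong[OF \<open>open S\<close> E] higher_differentiable_on_sum[OF \<open>open S\<close>]
        higher_differentiable_on_bilinear[OF bounded_bilinear_scaleR \<open>open S\<close>] Suc.IH) auto
  then show ?case using D by (auto simp: differentiable_def)
qed

section \<open>Smooth maps and their derivatives along curves\<close>

lemma smooth_on_subset: "smooth_on S f \<Longrightarrow> T \<subseteq> S \<Longrightarrow> smooth_on T f"
  by (auto simp: smooth_on_def intro: higher_differentiable_on_subset)

lemma smooth_on_const: "smooth_on S (\<lambda>x. c)"
  by (simp add: smooth_on_def higher_differentiable_on_const)

lemma smooth_on_compose:
  fixes f :: "'b::euclidean_space \<Rightarrow> 'c::real_normed_vector"
  assumes "open S" "open T" "g ` S \<subseteq> T" "smooth_on T f" "smooth_on S g"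
  shows "smooth_on S (\<lambda>x. f (g x))"
  using assms by (auto simp: smooth_on_def intro: higher_differentiable_on_compose)

lemma smooth_on_frechet_derivative:
  "smooth_on S f \<Longrightarrow> smooth_on S (\<lambda>x. frechet_derivative f (at x) v)"
  using higher_differentiable_on.simps(2) unfolding smooth_on_def by blast

lemma smooth_on_has_derivative:
  assumes "smooth_on S f" "x \<in> S"
  shows "(f has_derivative frechet_derivative f (at x)) (at x)"
proof -
  have "higher_differentiable_on S f (Suc 0)" using assms(1) unfolding smooth_on_def by blast
  then show ?thesis using assms(2) by (simp add: frechet_derivative_works[symmetric])
qed

lemma smooth_on_linear:
  "smooth_on S f \<Longrightarrow> x \<in> S \<Longrightarrow> linear (frechet_derivative f (at x))"
  using has_derivative_linear smooth_on_has_derivative by blast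

lemma smooth_on_continuous_on: "smooth_on S f \<Longrightarrow> continuous_on S f"
  unfolding smooth_on_def using higher_differentiable_on.simps(1) by blast

lemma smooth_on_cong:
  "open S \<Longrightarrow> (\<And>x. x \<in> S \<Longrightarrow> f x = g x) \<Longrightarrow> smooth_on S f \<Longrightarrow> smooth_on S g"
  unfolding smooth_on_def using higher_differentiable_on_cong by blast

lemma smooth_on_inner:
  assumes "open S" "smooth_on S f"
  shows "smooth_on S (\<lambda>x. f x \<bullet> k)"
  using assms higher_differentiable_on_bilinear[OF bounded_bilinear_inner]
    higher_differentiable_on_const unfolding smooth_on_def by blast

text \<open>The device for differentiating an identity known only near one parameter value, such as
  homogeneity or the invariance of \<open>L\<close> under a flow.\<close>

lemma has_real_derivative_eq_ev:
  fixes f g :: "real \<Rightarrow> real"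
  assumes "\<forall>\<^sub>F t in nhds a. f t = g t" "(f has_real_derivative f') (at a)" "(g has_real_derivative g') (at a)"
  shows "f' = g'"
  using DERIV_cong_ev[OF refl assms(1) refl] assms(2,3) DERIV_unique by blast

text \<open>Homogeneity is available for positive factors only; this admits the factor
  \<open>1 + t\<close> on the ray through a vector.\<close>

lemma eventually_scale_pos: "\<forall>\<^sub>F t in nhds (0::real). 1 + t > 0"
proof -
  have "((\<lambda>t::real. 1 + t) \<longlongrightarrow> 1 + 0) (nhds 0)"
    by (intro tendsto_intros filterlim_ident)
  then show ?thesis using order_tendstoD(1)[of "\<lambda>t::real. 1 + t" 1 "nhds 0" 0] by simp
qed

lemma has_vector_derivative_compose_frechet:
  assumes "smooth_on S f" "g t \<in> S" "(g has_vector_derivative g') (at t within I)"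
  shows "((\<lambda>s. f (g s)) has_vector_derivative frechet_derivative f (at (g t)) g') (at t within I)"
  using vector_derivative_diff_chain_within[OF assms(3), of f "frechet_derivative f (at (g t))"]
    has_derivative_at_withinI[OF smooth_on_has_derivative[OF assms(1,2)]] by (simp add: o_def)

text \<open>Product rule for a derivative taken at a moving point in a moving direction. It applies
  to the momentum, where the base point, the velocity and the value of the Killing field all depend
  on time.\<close>

lemma has_vector_derivative_frechet_derivative_apply:
  fixes f :: "'a::euclidean_space \<Rightarrow> 'b::real_normed_vector"
  assumes "open S" and f: "smooth_on S f" and zS: "z t \<in> S" and "t \<in> I"
    and z: "(z has_vector_derivative z') (at t within I)"
    and k: "(k has_vector_derivative k') (at t within I)"
  shows "((\<lambda>s. frechet_derivative f (at (z s)) (k s)) has_vector_derivative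
      frechet_derivative (\<lambda>u. frechet_derivative f (at u) (k t)) (at (z t)) z'
      + frechet_derivative f (at (z t)) k') (at t within I)"
proof -
  let ?D = "\<lambda>u. frechet_derivative f (at u)"
  let ?D2 = "\<lambda>v. frechet_derivative (\<lambda>u. ?D u v) (at (z t))"
  have D2: "((\<lambda>u. ?D u v) has_derivative ?D2 v) (at (z t))" for v
    by (rule smooth_on_has_derivative[OF smooth_on_frechet_derivative[OF f] zS])
  have lin: "linear (?D u)" if "u \<in> S" for u
    using f that by (rule smooth_on_linear)
  have "((\<lambda>s. \<Sum>i\<in>Basis. (k s \<bullet> i) *\<^sub>R ?D (z s) i) has_vector_derivative
      (\<Sum>i\<in>Basis. (k t \<bullet> i) *\<^sub>R ?D2 i z' + (k' \<bullet> i) *\<^sub>R ?D (z t) i)) (at t within I)"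
  proof (intro has_vector_derivative_sum)
    fix i :: 'a
    have "((\<lambda>s. ?D (z s) i) has_vector_derivative ?D2 i z') (at t within I)"
      by (rule has_vector_derivative_compose_frechet[OF smooth_on_frechet_derivative[OF f] zS z])
    moreover have "((\<lambda>s. k s \<bullet> i) has_real_derivative k' \<bullet> i) (at t within I)"
      unfolding has_real_derivative_iff_has_vector_derivative
      by (rule bounded_linear.has_vector_derivative[OF bounded_linear_inner_left k])
    ultimately show "((\<lambda>s. (k s \<bullet> i) *\<^sub>R ?D (z s) i) has_vector_derivative
        (k t \<bullet> i) *\<^sub>R ?D2 i z' + (k' \<bullet> i) *\<^sub>R ?D (z t) i) (at t within I)"
      by (intro has_vector_derivative_scaleR)
  qed
  \<comment> \<open>Reassembles the second derivatives in basis directions into the one whose first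
    direction is frozen at \<open>k t\<close>.\<close>
  moreover have "?D2 (k t) z' = (\<Sum>i\<in>Basis. (k t \<bullet> i) *\<^sub>R ?D2 i z')"
  proof -
    have "((\<lambda>u. \<Sum>i\<in>Basis. (k t \<bullet> i) *\<^sub>R ?D u i) has_derivative
        (\<lambda>h. \<Sum>i\<in>Basis. (k t \<bullet> i) *\<^sub>R ?D2 i h)) (at (z t))"
      by (intro has_derivative_sum has_derivative_scaleR_right D2)
    then have "((\<lambda>u. ?D u (k t)) has_derivative
        (\<lambda>h. \<Sum>i\<in>Basis. (k t \<bullet> i) *\<^sub>R ?D2 i h)) (at (z t))"
      using has_derivative_transform_within_open[OF _ \<open>open S\<close> zS]
        linear_euclidean_expansion[OF lin, symmetric] by fastforce
    from fun_cong[OF frechet_derivative_at[OF this], of z'] show ?thesis by simp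
  qed
  ultimately have "((\<lambda>s. \<Sum>i\<in>Basis. (k s \<bullet> i) *\<^sub>R ?D (z s) i) has_vector_derivative
      ?D2 (k t) z' + ?D (z t) k') (at t within I)"
    using linear_euclidean_expansion[OF lin[OF zS], of k'] by (simp add: sum.distrib)
  \<comment> \<open>The derivative of \<open>f\<close> is known to be linear on \<open>S\<close>
    only, so the expansion is valid just for times near \<open>t\<close>.\<close>
  moreover have "\<forall>\<^sub>F s in at t within I. z s \<in> S"
    using has_vector_derivative_continuous[OF z] \<open>open S\<close> zS
    by (auto simp: continuous_within dest: topological_tendstoD)
  then have "\<forall>\<^sub>F s in at t within I. (\<Sum>i\<in>Basis. (k s \<bullet> i) *\<^sub>R ?D (z s) i) = ?D (z s) (k s)"
    by eventually_elim (metis linear_euclidean_expansion[OF lin])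
  ultimately show ?thesis
    unfolding has_vector_derivative_def
    by (elim has_derivative_transform_eventually)
      (use zS \<open>t \<in> I\<close> linear_euclidean_expansion[OF lin[OF zS], of "k t"] in auto)
qed

lemma smooth_on_line_derivative:
  fixes f :: "'a::real_normed_vector \<Rightarrow> real"
  assumes "smooth_on S f" "x + t *\<^sub>R v \<in> S"
  shows "((\<lambda>t. f (x + t *\<^sub>R v)) has_real_derivative frechet_derivative f (at (x + t *\<^sub>R v)) v) (at t)"
proof -
  have "((\<lambda>t. x + t *\<^sub>R v) has_vector_derivative v) (at t)"
    by (auto simp: has_vector_derivative_def intro!: derivative_eq_intros)
  from has_vector_derivative_compose_frechet[OF assms(1) _ this] assms(2) show ?thesis
    by (simp add: has_real_derivative_iff_has_vector_derivative)
qed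

section \<open>Symmetry of second derivatives\<close>

lemma second_difference_mvt:
  fixes f :: "'a::real_normed_vector \<Rightarrow> real"
  assumes f: "smooth_on S f" and "h > 0"
    and S: "\<And>a b. 0 \<le> a \<Longrightarrow> a \<le> h \<Longrightarrow> 0 \<le> b \<Longrightarrow> b \<le> h \<Longrightarrow> x + a *\<^sub>R u + b *\<^sub>R w \<in> S"
  obtains a b where "0 \<le> a" "a \<le> h" "0 \<le> b" "b \<le> h"
    "f (x + h *\<^sub>R u + h *\<^sub>R w) - f (x + h *\<^sub>R u) - f (x + h *\<^sub>R w) + f x =
      h\<^sup>2 * frechet_derivative (\<lambda>z. frechet_derivative f (at z) u) (at (x + a *\<^sub>R u + b *\<^sub>R w)) w"
proof -
  let ?fu = "\<lambda>z. frechet_derivative f (at z) u"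
  let ?g = "\<lambda>a. f (x + a *\<^sub>R u + h *\<^sub>R w) - f (x + a *\<^sub>R u)"
  \<comment> \<open>First mean value step: vary the position along \<open>u\<close> while the
    increment along \<open>w\<close> is kept whole.\<close>
  have "(?g has_real_derivative ?fu (x + a *\<^sub>R u + h *\<^sub>R w) - ?fu (x + a *\<^sub>R u)) (at a)"
    if "0 \<le> a" "a \<le> h" for a
    using smooth_on_line_derivative[OF f, of "x + h *\<^sub>R w" a u]
      smooth_on_line_derivative[OF f, of x a u] S[OF that, of h] S[OF that, of 0] \<open>h > 0\<close>
    by (intro DERIV_diff) (auto simp: algebra_simps)
  from MVT2[OF \<open>h > 0\<close> this] obtain a where a: "0 < a" "a < h"
    "?g h - ?g 0 = (h - 0) * (?fu (x + a *\<^sub>R u + h *\<^sub>R w) - ?fu (x + a *\<^sub>R u))"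
    by blast
  \<comment> \<open>Second mean value step: the remaining increment of the
    \<open>u\<close>-derivative is resolved along \<open>w\<close>.\<close>
  have "((\<lambda>b. ?fu (x + a *\<^sub>R u + b *\<^sub>R w)) has_real_derivative
      frechet_derivative ?fu (at (x + a *\<^sub>R u + b *\<^sub>R w)) w) (at b)" if "0 \<le> b" "b \<le> h" for b
    using a S that by (intro smooth_on_line_derivative[OF smooth_on_frechet_derivative[OF f]]) auto
  from MVT2[OF \<open>h > 0\<close> this] obtain b where b: "0 < b" "b < h"
    "?fu (x + a *\<^sub>R u + h *\<^sub>R w) - ?fu (x + a *\<^sub>R u + 0 *\<^sub>R w) =
      (h - 0) * frechet_derivative ?fu (at (x + a *\<^sub>R u + b *\<^sub>R w)) w"
    by blast
  show thesis
    using that[of a b] a b by (simp add: power2_eq_square algebra_simps)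
qed

text \<open>Schwarz's theorem. The second difference over a parallelogram does not change when
  \<open>u\<close> and \<open>w\<close> are exchanged, yet it is \<open>h\<^sup>2\<close> times
  either mixed derivative at some point of the parallelogram. Continuity then forces the two values
  at \<open>x\<close> to agree.\<close>

lemma second_frechet_derivative_symmetric_real:
  fixes f :: "'a::real_normed_vector \<Rightarrow> real"
  assumes "open S" and f: "smooth_on S f" and "x \<in> S"
  shows "frechet_derivative (\<lambda>z. frechet_derivative f (at z) u) (at x) w =
    frechet_derivative (\<lambda>z. frechet_derivative f (at z) w) (at x) u" (is "?P x = ?Q x")
proof (rule ccontr)
  assume neq: "?P x \<noteq> ?Q x"
  \<comment> \<open>Half the supposed gap: two errors below \<open>d\<close> cannot bridge
    it.\<close>
  define d where "d = \<bar>?P x - ?Q x\<bar> / 2"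
  have "d > 0" using neq by (simp add: d_def)
  have cont: "continuous (at x) ?P" "continuous (at x) ?Q"
    using f assms smooth_on_frechet_derivative smooth_on_continuous_on continuous_on_eq_continuous_at
    by blast+
  obtain e1 where e1: "e1 > 0" "\<And>z. dist z x < e1 \<Longrightarrow> dist (?P z) (?P x) < d"
    using cont(1) \<open>d > 0\<close> unfolding continuous_at_eps_delta by blast
  obtain e2 where e2: "e2 > 0" "\<And>z. dist z x < e2 \<Longrightarrow> dist (?Q z) (?Q x) < d"
    using cont(2) \<open>d > 0\<close> unfolding continuous_at_eps_delta by blast
  obtain e3 where e3: "e3 > 0" "ball x e3 \<subseteq> S"
    using assms open_contains_ball by blast
  define e where "e = min e1 (min e2 e3)"
  \<comment> \<open>Keeps the whole parallelogram within distance \<open>e\<close> of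
    \<open>x\<close>; the summand 1 covers the case that both \<open>u\<close> and \<open>w\<close>
    vanish.\<close>
  define h where "h = e / (norm u + norm w + 1)"
  have pos: "norm u + norm w + 1 > 0" by (meson add_nonneg_pos norm_ge_zero add_nonneg_nonneg zero_less_one)
  have "e > 0" using e1 e2 e3 by (simp add: e_def)
  then have "h > 0" using pos by (simp add: h_def)
  have near: "dist (x + a *\<^sub>R u + b *\<^sub>R w) x < e" if "0 \<le> a" "a \<le> h" "0 \<le> b" "b \<le> h" for a b
  proof -
    have "norm (a *\<^sub>R u + b *\<^sub>R w) \<le> a * norm u + b * norm w"
      using norm_triangle_ineq[of "a *\<^sub>R u" "b *\<^sub>R w"] that by simp
    also have "\<dots> \<le> h * norm u + h * norm w"
      using that by (intro add_mono mult_right_mono) auto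
    also have "\<dots> < h * (norm u + norm w + 1)" using \<open>h > 0\<close> by (simp add: algebra_simps)
    also have "\<dots> = e" using pos by (simp add: h_def)
    finally show ?thesis by (simp add: dist_norm add.assoc)
  qed
  then have inS: "x + a *\<^sub>R u + b *\<^sub>R w \<in> S" if "0 \<le> a" "a \<le> h" "0 \<le> b" "b \<le> h" for a b
    using that e3 by (force simp: e_def dist_commute)
  obtain a b where ab: "0 \<le> a" "a \<le> h" "0 \<le> b" "b \<le> h"
    "f (x + h *\<^sub>R u + h *\<^sub>R w) - f (x + h *\<^sub>R u) - f (x + h *\<^sub>R w) + f x
      = h\<^sup>2 * ?P (x + a *\<^sub>R u + b *\<^sub>R w)"
    using second_difference_mvt[OF f \<open>h > 0\<close> inS] by blast
  have "x + a *\<^sub>R w + b *\<^sub>R u \<in> S" if "0 \<le> a" "a \<le> h" "0 \<le> b" "b \<le> h" for a b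
    using inS[of b a] that by (simp add: algebra_simps)
  then obtain b' a' where ab': "0 \<le> b'" "b' \<le> h" "0 \<le> a'" "a' \<le> h"
    "f (x + h *\<^sub>R w + h *\<^sub>R u) - f (x + h *\<^sub>R w) - f (x + h *\<^sub>R u) + f x
      = h\<^sup>2 * ?Q (x + b' *\<^sub>R w + a' *\<^sub>R u)"
    using second_difference_mvt[OF f \<open>h > 0\<close>, of x w u] by blast
  let ?z = "x + a *\<^sub>R u + b *\<^sub>R w" and ?z' = "x + a' *\<^sub>R u + b' *\<^sub>R w"
  have "h\<^sup>2 * ?P ?z = h\<^sup>2 * ?Q ?z'"
    using ab(5) ab'(5) by (simp add: algebra_simps)
  then have "?P ?z = ?Q ?z'" using \<open>h > 0\<close> by simp
  moreover have "dist (?P ?z) (?P x) < d" "dist (?Q ?z') (?Q x) < d"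
    using near[OF ab(1-4)] near[OF ab'(3,4,1,2)] by (auto intro!: e1 e2 simp: e_def)
  ultimately have "\<bar>?P x - ?Q x\<bar> < d + d"
    unfolding dist_real_def by linarith
  then show False by (simp add: d_def)
qed

text \<open>Reduces to real components. Vector values occur for the flow of a vector field read in a
  chart.\<close>

lemma second_frechet_derivative_symmetric:
  fixes f :: "'a::real_normed_vector \<Rightarrow> 'b::euclidean_space"
  assumes "open S" and f: "smooth_on S f" and "x \<in> S"
  shows "frechet_derivative (\<lambda>z. frechet_derivative f (at z) u) (at x) w =
    frechet_derivative (\<lambda>z. frechet_derivative f (at z) w) (at x) u"
proof (rule euclidean_eqI)
  fix k :: 'b
  have inner: "frechet_derivative (\<lambda>z. F z \<bullet> k) (at z) v = frechet_derivative F (at z) v \<bullet> k"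
    if "smooth_on S F" "z \<in> S" for F :: "'a \<Rightarrow> 'b" and z v
    using frechet_derivative_at[OF has_derivative_inner_left[OF smooth_on_has_derivative[OF that]]]
    by metis
  have "frechet_derivative (\<lambda>z. frechet_derivative f (at z) u) (at x) w \<bullet> k =
      frechet_derivative (\<lambda>z. frechet_derivative (\<lambda>z. f z \<bullet> k) (at z) u) (at x) w" for u w
  proof -
    have "frechet_derivative (\<lambda>z. frechet_derivative f (at z) u) (at x) w \<bullet> k =
        frechet_derivative (\<lambda>z. frechet_derivative f (at z) u \<bullet> k) (at x) w"
      by (rule inner[symmetric]) (use f smooth_on_frechet_derivative \<open>x \<in> S\<close> in auto)
    also have "\<dots> = frechet_derivative (\<lambda>z. frechet_derivative (\<lambda>z. f z \<bullet> k) (at z) u) (at x) w"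
      \<comment> \<open>The componentwise formula is itself differentiated here, so it has to hold
        on all of \<open>S\<close> and not only at \<open>x\<close>.\<close>
      using smooth_on_has_derivative[OF smooth_on_inner[OF \<open>open S\<close> smooth_on_frechet_derivative[OF f]] \<open>x \<in> S\<close>]
      by (intro fun_cong[OF frechet_derivative_transform_within_open[OF _ \<open>open S\<close> \<open>x \<in> S\<close>]]
          inner[OF f, symmetric]) (auto simp: differentiable_def)
    finally show ?thesis .
  qed
  then show "frechet_derivative (\<lambda>z. frechet_derivative f (at z) u) (at x) w \<bullet> k =
      frechet_derivative (\<lambda>z. frechet_derivative f (at z) w) (at x) u \<bullet> k"
    using second_frechet_derivative_symmetric_real[OF \<open>open S\<close> smooth_on_inner[OF \<open>open S\<close> f] \<open>x \<in> S\<close>]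
    by metis
qed


section \<open>Charts, tangent vectors and curves\<close>

locale smooth_manifold =
  fixes A :: "('m::{t2_space, second_countable_topology}, 'e::euclidean_space) chart set"
  assumes atlas: "smooth_atlas A"
begin

section \<open>Charts and transition maps\<close>

lemma chart_at_mem: "chart_at A p \<in> A" and mem_chart_at: "p \<in> cdom (chart_at A p)"
proof -
  have "\<exists>c. c \<in> A \<and> p \<in> cdom c" using atlas unfolding smooth_atlas_def by blast
  then have "chart_at A p \<in> A \<and> p \<in> cdom (chart_at A p)"
    unfolding chart_at_def by (rule someI_ex)
  then show "chart_at A p \<in> A" "p \<in> cdom (chart_at A p)" by auto
qed

lemma open_cdom: "c \<in> A \<Longrightarrow> open (cdom c)"
  and chart_homeomorphism:
    "c \<in> A \<Longrightarrow> homeomorphism (cdom c) (cmap c ` cdom c) (cmap c) (cinv c)"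
  and open_cmap_cdom: "c \<in> A \<Longrightarrow> open (cmap c ` cdom c)"
  using atlas unfolding smooth_atlas_def by blast+

lemma cinv_cmap: "c \<in> A \<Longrightarrow> p \<in> cdom c \<Longrightarrow> cinv c (cmap c p) = p"
  using chart_homeomorphism homeomorphism_apply1 by blast

lemma continuous_on_cmap: "c \<in> A \<Longrightarrow> continuous_on (cdom c) (cmap c)"
  using chart_homeomorphism homeomorphism_cont1 by blast

lemma open_cmap_image:
  assumes "c \<in> A" "open W"
  shows "open (cmap c ` (W \<inter> cdom c))"
proof -
  have "openin (top_of_set (cdom c)) (W \<inter> cdom c)"
    using assms(2) by (metis inf_commute openin_open_Int)
  then have "openin (top_of_set (cmap c ` cdom c)) (cmap c ` (W \<inter> cdom c))"
    using homeomorphism_imp_open_map[OF chart_homeomorphism[OF assms(1)]] by blast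
  then show ?thesis using open_cmap_cdom[OF assms(1)] openin_open_trans by blast
qed

lemma open_chart_overlap: "c \<in> A \<Longrightarrow> d \<in> A \<Longrightarrow> open (cmap c ` (cdom c \<inter> cdom d))"
  using open_cmap_image[of c "cdom d"] open_cdom by (simp add: Int_commute)

lemma smooth_transition:
  "c \<in> A \<Longrightarrow> d \<in> A \<Longrightarrow> smooth_on (cmap c ` (cdom c \<inter> cdom d)) (\<lambda>x. cmap d (cinv c x))"
  using atlas unfolding smooth_atlas_def o_def by blast

lemma has_derivative_transition:
  assumes "c \<in> A" "d \<in> A" "p \<in> cdom c" "p \<in> cdom d"
  shows "((\<lambda>x. cmap d (cinv c x)) has_derivative transition_deriv c d p) (at (cmap c p))"
  using smooth_on_has_derivative[OF smooth_transition[OF assms(1,2)]] assms(3,4)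
  by (simp add: transition_deriv_def o_def)

lemma linear_transition_deriv:
  assumes "c \<in> A" "d \<in> A" "p \<in> cdom c" "p \<in> cdom d"
  shows "linear (transition_deriv c d p)"
  using has_derivative_transition[OF assms] has_derivative_linear by blast

lemma transition_deriv_self:
  assumes "c \<in> A" "p \<in> cdom c"
  shows "transition_deriv c c p y = y"
proof -
  have "((\<lambda>x. x) has_derivative transition_deriv c c p) (at (cmap c p))"
    by (rule has_derivative_transform_within_open[OF
        has_derivative_transition[OF assms(1) assms(1) assms(2) assms(2)]
        open_cmap_cdom[OF assms(1)]]) (use assms in \<open>auto simp: cinv_cmap\<close>)
  then show ?thesis by (metis frechet_derivative_at frechet_derivative_ident)
qed

text \<open>Chain rule for two successive transition maps, whose composite is the direct transition
  near the point. This cocycle rule makes \<open>tvec_of\<close> satisfy the transformation law of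
  tangent vectors.\<close>

lemma transition_deriv_trans:
  assumes "c \<in> A" "d \<in> A" "e \<in> A" "p \<in> cdom c" "p \<in> cdom d" "p \<in> cdom e"
  shows "transition_deriv d e p (transition_deriv c d p y) = transition_deriv c e p y"
proof -
  have "((\<lambda>x. cmap e (cinv d (cmap d (cinv c x)))) has_derivative
      (\<lambda>y. transition_deriv d e p (transition_deriv c d p y))) (at (cmap c p))"
    using has_derivative_compose[OF has_derivative_transition[OF assms(1,2,4,5)]]
      has_derivative_transition[OF assms(2,3,5,6)] assms by (simp add: cinv_cmap)
  then have "((\<lambda>x. cmap e (cinv c x)) has_derivative
      (\<lambda>y. transition_deriv d e p (transition_deriv c d p y))) (at (cmap c p))"
    by (rule has_derivative_transform_within_open[OF _ open_chart_overlap[OF assms(1,2)]])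
      (use assms in \<open>auto simp: cinv_cmap\<close>)
  then show ?thesis
    using has_derivative_transition[OF assms(1,3,4,6)] has_derivative_unique by metis
qed

section \<open>Tangent vectors and coordinate fields\<close>

lemma tangent_space_outside: "\<xi> \<in> tangent_space A p \<Longrightarrow> \<not> (c \<in> A \<and> p \<in> cdom c) \<Longrightarrow> \<xi> c = 0"
  unfolding tangent_space_def by blast

lemma tangent_space_transition:
  assumes "\<xi> \<in> tangent_space A p" "c \<in> A" "d \<in> A" "p \<in> cdom c" "p \<in> cdom d"
  shows "transition_deriv c d p (\<xi> c) = \<xi> d"
proof (rule sym)
  show "\<xi> d = transition_deriv c d p (\<xi> c)"
    using assms unfolding tangent_space_def by blast
qed

lemma tangent_spaceI:
  assumes "\<And>c. \<not> (c \<in> A \<and> p \<in> cdom c) \<Longrightarrow> \<xi> c = 0"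
    and "\<And>c d. c \<in> A \<Longrightarrow> d \<in> A \<Longrightarrow> p \<in> cdom c \<Longrightarrow> p \<in> cdom d \<Longrightarrow> transition_deriv c d p (\<xi> c) = \<xi> d"
  shows "\<xi> \<in> tangent_space A p"
  unfolding tangent_space_def
  by (intro CollectI conjI allI ballI impI assms(1) assms(2)[symmetric]) auto

lemma tvec_of_component:
  "c \<in> A \<Longrightarrow> p \<in> cdom c \<Longrightarrow> tvec_of A c p y c = y"
  by (simp add: tvec_of_def transition_deriv_self)

lemma tvec_of_in_tangent_space:
  "c \<in> A \<Longrightarrow> p \<in> cdom c \<Longrightarrow> tvec_of A c p y \<in> tangent_space A p"
  by (rule tangent_spaceI) (auto simp: tvec_of_def transition_deriv_trans)

lemma tvec_of_eq:
  assumes "\<xi> \<in> tangent_space A p" "c \<in> A" "p \<in> cdom c"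
  shows "tvec_of A c p (\<xi> c) = \<xi>"
proof
  fix d
  show "tvec_of A c p (\<xi> c) d = \<xi> d"
    using tangent_space_transition[OF assms(1,2) _ assms(3), of d] tangent_space_outside[OF assms(1), of d]
    by (auto simp: tvec_of_def)
qed

lemma tvec_of_add:
  "c \<in> A \<Longrightarrow> p \<in> cdom c \<Longrightarrow> tvec_of A c p (y + z) = tvec_of A c p y +\<^sub>T tvec_of A c p z"
  by (auto simp: tvec_of_def tadd_def fun_eq_iff intro: linear_add[OF linear_transition_deriv])

lemma tvec_of_scale:
  "c \<in> A \<Longrightarrow> p \<in> cdom c \<Longrightarrow> tvec_of A c p (r *\<^sub>R y) = r *\<^sub>T tvec_of A c p y"
  by (auto simp: tvec_of_def tscale_def fun_eq_iff intro: linear_cmul[OF linear_transition_deriv])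

lemma tangent_space_add:
  "\<xi> \<in> tangent_space A p \<Longrightarrow> \<eta> \<in> tangent_space A p \<Longrightarrow> \<xi> +\<^sub>T \<eta> \<in> tangent_space A p"
  by (rule tangent_spaceI)
    (auto simp: tadd_def linear_add[OF linear_transition_deriv] tangent_space_transition tangent_space_outside)

lemma tangent_space_scale:
  "\<xi> \<in> tangent_space A p \<Longrightarrow> r *\<^sub>T \<xi> \<in> tangent_space A p"
  by (rule tangent_spaceI)
    (auto simp: tscale_def linear_cmul[OF linear_transition_deriv] tangent_space_transition tangent_space_outside)

text \<open>Seen in another chart \<open>d\<close>, the field is the derivative of the transition
  map in the fixed direction \<open>a\<close>, evaluated along the inverse transition; both
  ingredients are smooth.\<close>

lemma coord_field_vector_field:
  assumes c: "c \<in> A" and "open W" "W \<subseteq> cdom c"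
  shows "vector_field_on A W (coord_field A c a)"
  unfolding vector_field_on_def coord_field_def
proof (intro conjI ballI)
  fix d assume d: "d \<in> A"
  let ?S = "cmap d ` (W \<inter> cdom d)"
  let ?t = "\<lambda>x. cmap d (cinv c x)"
  have oS: "open ?S" using open_cmap_image[OF d \<open>open W\<close>] .
  have "smooth_on ?S (\<lambda>x. frechet_derivative ?t (at (cmap c (cinv d x))) a)"
  proof (rule smooth_on_compose[OF oS open_chart_overlap[OF c d] _
        smooth_on_frechet_derivative[OF smooth_transition[OF c d]]])
    show "(\<lambda>x. cmap c (cinv d x)) ` ?S \<subseteq> cmap c ` (cdom c \<inter> cdom d)"
      using assms d by (auto simp: cinv_cmap)
    show "smooth_on ?S (\<lambda>x. cmap c (cinv d x))"
      by (rule smooth_on_subset[OF smooth_transition[OF d c]]) (use assms in auto)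
  qed
  then show "smooth_on ?S (\<lambda>x. tvec_of A c (cinv d x) a d)"
    by (rule smooth_on_cong[OF oS, rotated])
      (use assms d in \<open>auto simp: cinv_cmap tvec_of_def transition_deriv_def o_def\<close>)
qed (use assms in \<open>auto intro: tvec_of_in_tangent_space\<close>)

lemma vector_field_component_smooth:
  assumes "vector_field_on A W X" "c \<in> A"
  shows "smooth_on (cmap c ` (W \<inter> cdom c)) (\<lambda>x. X (cinv c x) c)"
  using assms by (auto simp: vector_field_on_def)

section \<open>Curves and velocities in a chart\<close>

lemma smooth_curve_in_chart:
  assumes \<gamma>: "smooth_curve A I \<gamma>" and "t \<in> I" and c: "c \<in> A" "\<gamma> t \<in> cdom c"
  obtains \<epsilon> h where "\<epsilon> > 0" "smooth_on (ball t \<epsilon>) h"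
    "\<And>s. s \<in> I \<Longrightarrow> s \<in> ball t \<epsilon> \<Longrightarrow> \<gamma> s \<in> cdom c \<and> cmap c (\<gamma> s) = h s"
proof -
  obtain d \<delta> k where d: "d \<in> A" "\<delta> > 0" "smooth_on (ball t \<delta>) k"
    "\<And>s. s \<in> I \<Longrightarrow> s \<in> ball t \<delta> \<Longrightarrow> \<gamma> s \<in> cdom d \<and> cmap d (\<gamma> s) = k s"
    using \<gamma> \<open>t \<in> I\<close> unfolding smooth_curve_def by blast
  let ?T = "cmap d ` (cdom d \<inter> cdom c)"
  have oT: "open ?T" using open_chart_overlap[OF d(1) c(1)] .
  have kt: "k t \<in> ?T" using d(2) d(4)[OF \<open>t \<in> I\<close>] c by force
  \<comment> \<open>The curve is given in some chart \<open>d\<close>, so its extension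
    \<open>k\<close> must be carried over to \<open>c\<close>. The interval is shrunk until
    \<open>k\<close> stays in the chart overlap, also at times outside \<open>I\<close>.\<close>
  have "open (ball t \<delta> \<inter> k -` ?T)"
    using smooth_on_continuous_on[OF d(3)] oT continuous_on_open_vimage[OF open_ball] by (metis Int_commute)
  then obtain \<epsilon> where \<epsilon>: "\<epsilon> > 0" "ball t \<epsilon> \<subseteq> ball t \<delta> \<inter> k -` ?T"
    using open_contains_ball[of "ball t \<delta> \<inter> k -` ?T"] kt d(2)
    by (meson IntI centre_in_ball vimageI2)
  show thesis
  proof (rule that[of \<epsilon> "\<lambda>s. cmap c (cinv d (k s))"])
    show "smooth_on (ball t \<epsilon>) (\<lambda>s. cmap c (cinv d (k s)))"
      by (rule smooth_on_compose[OF open_ball oT _ smooth_transition[OF d(1) c(1)]])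
        (use \<epsilon> smooth_on_subset[OF d(3)] in auto)
  next
    fix s assume s: "s \<in> I" "s \<in> ball t \<epsilon>"
    then have "s \<in> ball t \<delta>" "k s \<in> ?T" using \<epsilon> by auto
    then have "\<gamma> s \<in> cdom d" "cmap d (\<gamma> s) = k s" using d s by auto
    moreover obtain q where "q \<in> cdom d \<inter> cdom c" "k s = cmap d q"
      using \<open>k s \<in> ?T\<close> by auto
    ultimately show "\<gamma> s \<in> cdom c \<and> cmap c (\<gamma> s) = cmap c (cinv d (k s))"
      by (metis Int_iff cinv_cmap d(1))
  qed (fact \<epsilon>)
qed

text \<open>An interval with interior has no isolated points, so derivatives within \<open>I\<close>
  are unique, including those at end points.\<close>

lemma smooth_curve_at_neq_bot:
  assumes "smooth_curve A I \<gamma>" "t \<in> I"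
  shows "at t within I \<noteq> bot"
proof -
  have "connected I" "interior I \<noteq> {}"
    using assms(1) is_interval_connected by (auto simp: smooth_curve_def)
  then have "I \<noteq> {x}" for x by auto
  with connected_imp_perfect[OF \<open>connected I\<close> \<open>t \<in> I\<close>] show ?thesis
    using trivial_limit_within by blast
qed

text \<open>Everything is read off a smooth extension \<open>h\<close> in the chart: on
  \<open>I\<close> near \<open>t\<close> the velocity is the derivative of \<open>h\<close>, even at
  an end point of \<open>I\<close>.\<close>

lemma smooth_curve_velocity:
  assumes \<gamma>: "smooth_curve A I \<gamma>" and "t \<in> I" and c: "c \<in> A" "\<gamma> t \<in> cdom c"
  shows "\<forall>\<^sub>F s in at t within I. \<gamma> s \<in> cdom c"
    and "((\<lambda>s. cmap c (\<gamma> s)) has_vector_derivative velocity A I \<gamma> t c) (at t within I)"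
    and "(\<lambda>s. velocity A I \<gamma> s c) differentiable (at t within I)"
proof -
  obtain \<epsilon> h where h: "\<epsilon> > 0" "smooth_on (ball t \<epsilon>) h"
    "\<And>s. s \<in> I \<Longrightarrow> s \<in> ball t \<epsilon> \<Longrightarrow> \<gamma> s \<in> cdom c \<and> cmap c (\<gamma> s) = h s"
    using smooth_curve_in_chart[OF assms] by blast
  have near: "\<forall>\<^sub>F s in at t within I. s \<in> I \<and> s \<in> ball t \<epsilon>"
    using h(1) unfolding eventually_at by (auto simp: dist_commute)
  then show "\<forall>\<^sub>F s in at t within I. \<gamma> s \<in> cdom c"
    by eventually_elim (use h in auto)
  have D: "((\<lambda>s. cmap c (\<gamma> s)) has_vector_derivative frechet_derivative h (at s) 1) (at s within I)"
    if s: "s \<in> I" "s \<in> ball t \<epsilon>" for s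
  proof -
    have "(h has_vector_derivative frechet_derivative h (at s) 1) (at s within I)"
      using has_vector_derivative_compose_frechet[OF h(2), of "\<lambda>s. s" s 1 I] s by simp
    moreover have "\<forall>\<^sub>F r in at s within I. r \<in> I \<and> r \<in> ball t \<epsilon>"
      using eventually_at_in_open'[of "ball t \<epsilon>" s] s
      by (auto simp: eventually_at_filter elim: eventually_mono)
    then have "\<forall>\<^sub>F r in at s within I. h r = cmap c (\<gamma> r)"
      by eventually_elim (use h in auto)
    ultimately show ?thesis
      unfolding has_vector_derivative_def
      by (elim has_derivative_transform_eventually) (use h s in auto)
  qed
  have vel: "velocity A I \<gamma> s c = frechet_derivative h (at s) 1" if s: "s \<in> I" "s \<in> ball t \<epsilon>" for s
    using vector_derivative_within[OF smooth_curve_at_neq_bot[OF \<gamma> s(1)] D[OF s]] c(1) h(3)[OF s]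
    by (simp add: velocity_def)
  show "((\<lambda>s. cmap c (\<gamma> s)) has_vector_derivative velocity A I \<gamma> t c) (at t within I)"
    using D vel \<open>t \<in> I\<close> h(1) by simp
  have "((\<lambda>s. frechet_derivative h (at s) 1) has_derivative
      frechet_derivative (\<lambda>s. frechet_derivative h (at s) 1) (at t)) (at t within I)"
    using smooth_on_has_derivative[OF smooth_on_frechet_derivative[OF h(2)]] h(1)
    by (simp add: has_derivative_at_withinI)
  moreover have "\<forall>\<^sub>F s in at t within I. frechet_derivative h (at s) 1 = velocity A I \<gamma> s c"
    using near by eventually_elim (use vel in auto)
  moreover have "frechet_derivative h (at t) 1 = velocity A I \<gamma> t c"
    using vel \<open>t \<in> I\<close> h(1) by simp
  ultimately have "((\<lambda>s. velocity A I \<gamma> s c) has_derivative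
      frechet_derivative (\<lambda>s. frechet_derivative h (at s) 1) (at t)) (at t within I)"
    by (rule has_derivative_transform_eventually) (fact \<open>t \<in> I\<close>)
  then show "(\<lambda>s. velocity A I \<gamma> s c) differentiable (at t within I)"
    by (auto simp: differentiable_def)
qed

end


section \<open>Conic pseudo-Finslerian metrics in a chart\<close>

text \<open>A conic Lagrangian in a chart: the first component of a pair is the base point, the second
  one the velocity.\<close>

locale conic_lagrangian =
  fixes \<Omega> :: "('e::euclidean_space \<times> 'e) set" and l :: "'e \<times> 'e \<Rightarrow> real"
  assumes open_dom: "open \<Omega>"
    and smooth: "smooth_on \<Omega> l"
    and conic: "(x, y) \<in> \<Omega> \<Longrightarrow> r > 0 \<Longrightarrow> (x, r *\<^sub>R y) \<in> \<Omega>"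
    and homogeneous: "(x, y) \<in> \<Omega> \<Longrightarrow> r > 0 \<Longrightarrow> l (x, r *\<^sub>R y) = r\<^sup>2 * l (x, y)"
begin

abbreviation dl :: "'e \<times> 'e \<Rightarrow> 'e \<times> 'e \<Rightarrow> real" where
  "dl z \<equiv> frechet_derivative l (at z)"

text \<open>The first direction \<open>w\<close> is vertical, the second arbitrary:
  \<open>ddl z w (0, u)\<close> is twice the fundamental tensor, while \<open>ddl z w (a, 0)\<close>
  is the mixed base-fibre derivative of metric compatibility.\<close>

abbreviation ddl :: "'e \<times> 'e \<Rightarrow> 'e \<Rightarrow> 'e \<times> 'e \<Rightarrow> real" where
  "ddl z w \<equiv> frechet_derivative (\<lambda>z. dl z (0, w)) (at z)"

text \<open>Repeats the iterated \<open>deriv\<close> of \<open>fund_tensor\<close>, so that passing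
  to a chart is plain rewriting.\<close>

definition tensor :: "'e \<times> 'e \<Rightarrow> 'e \<Rightarrow> 'e \<Rightarrow> real" where
  "tensor z u w = 1/2 * deriv (\<lambda>t. deriv (\<lambda>s. l (fst z, snd z + t *\<^sub>R u + s *\<^sub>R w)) 0) 0"

lemma has_derivative_dl: "z \<in> \<Omega> \<Longrightarrow> (l has_derivative dl z) (at z)"
  using smooth by (rule smooth_on_has_derivative)

lemma has_derivative_ddl: "z \<in> \<Omega> \<Longrightarrow> ((\<lambda>z. dl z (0, w)) has_derivative ddl z w) (at z)"
  using smooth_on_frechet_derivative[OF smooth] by (rule smooth_on_has_derivative)

lemma linear_dl: "z \<in> \<Omega> \<Longrightarrow> linear (dl z)"
  using has_derivative_dl has_derivative_linear by blast

lemma linear_ddl: "z \<in> \<Omega> \<Longrightarrow> linear (ddl z w)"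
  using has_derivative_ddl has_derivative_linear by blast

lemma eventually_line:
  assumes "z \<in> \<Omega>"
  shows "\<forall>\<^sub>F t in nhds (0::real). z + t *\<^sub>R v \<in> \<Omega>"
proof -
  have "((\<lambda>t. z + t *\<^sub>R v) \<longlongrightarrow> z + 0 *\<^sub>R v) (nhds 0)"
    by (intro tendsto_intros filterlim_ident)
  then show ?thesis using assms open_dom by (simp add: topological_tendstoD)
qed

lemma eventually_fibre_line: "(x, y) \<in> \<Omega> \<Longrightarrow> \<forall>\<^sub>F t in nhds (0::real). (x, y + t *\<^sub>R u) \<in> \<Omega>"
  using eventually_line[of "(x, y)" "(0, u)"] by simp

lemma dl_fibre_derivative:
  assumes "(x, y + t *\<^sub>R u) \<in> \<Omega>"
  shows "((\<lambda>t. l (x, y + t *\<^sub>R u)) has_real_derivative dl (x, y + t *\<^sub>R u) (0, u)) (at t)"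
  using smooth_on_line_derivative[OF smooth, of "(x, y)" t "(0, u)"] assms by simp

lemma ddl_fibre_derivative:
  assumes "(x, y + t *\<^sub>R u) \<in> \<Omega>"
  shows "((\<lambda>t. dl (x, y + t *\<^sub>R u) (0, w)) has_real_derivative ddl (x, y + t *\<^sub>R u) w (0, u)) (at t)"
  using smooth_on_line_derivative[OF smooth_on_frechet_derivative[OF smooth], of "(x, y)" t "(0, u)"]
    assms by simp

lemma tensor_eq_ddl:
  assumes "(x, y) \<in> \<Omega>"
  shows "tensor (x, y) u w = 1/2 * ddl (x, y) w (0, u)"
proof -
  have "\<forall>\<^sub>F t in nhds 0. deriv (\<lambda>s. l (x, y + t *\<^sub>R u + s *\<^sub>R w)) 0 = dl (x, y + t *\<^sub>R u) (0, w)"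
    using eventually_fibre_line[OF assms]
    by eventually_elim (use dl_fibre_derivative[where t = 0] in \<open>auto intro!: DERIV_imp_deriv\<close>)
  then have "deriv (\<lambda>t. deriv (\<lambda>s. l (x, y + t *\<^sub>R u + s *\<^sub>R w)) 0) 0 = deriv (\<lambda>t. dl (x, y + t *\<^sub>R u) (0, w)) 0"
    by (rule deriv_cong_ev) simp
  also have "\<dots> = ddl (x, y) w (0, u)"
    using ddl_fibre_derivative[of x y 0 u w] assms by (simp add: DERIV_imp_deriv)
  finally show ?thesis by (simp add: tensor_def)
qed

text \<open>Differentiating the degree-two homogeneity at \<open>y + t *\<^sub>R w\<close> produces
  one factor \<open>r\<close> on the left by linearity, which cancels: the fibre derivative has
  degree one.\<close>

lemma dl_homogeneous:
  assumes "(x, y) \<in> \<Omega>" "r > 0"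
  shows "dl (x, r *\<^sub>R y) (0, w) = r * dl (x, y) (0, w)"
proof -
  have "\<forall>\<^sub>F t in nhds 0. l (x, r *\<^sub>R y + t *\<^sub>R (r *\<^sub>R w)) = r\<^sup>2 * l (x, y + t *\<^sub>R w)"
    using eventually_fibre_line[OF assms(1), of w]
    by eventually_elim (use homogeneous[OF _ assms(2)] in \<open>force simp: scaleR_add_right mult.commute\<close>)
  moreover have "((\<lambda>t. l (x, r *\<^sub>R y + t *\<^sub>R (r *\<^sub>R w))) has_real_derivative dl (x, r *\<^sub>R y) (0, r *\<^sub>R w)) (at 0)"
    using dl_fibre_derivative[of x "r *\<^sub>R y" 0 "r *\<^sub>R w"] conic[OF assms] by simp
  moreover have "((\<lambda>t. r\<^sup>2 * l (x, y + t *\<^sub>R w)) has_real_derivative r\<^sup>2 * dl (x, y) (0, w)) (at 0)"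
    using dl_fibre_derivative[of x y 0 w] assms(1) by (intro DERIV_cmult) simp
  ultimately have "dl (x, r *\<^sub>R y) (0, r *\<^sub>R w) = r\<^sup>2 * dl (x, y) (0, w)"
    by (rule has_real_derivative_eq_ev)
  moreover have "dl (x, r *\<^sub>R y) (0, r *\<^sub>R w) = r * dl (x, r *\<^sub>R y) (0, w)"
    using linear_cmul[OF linear_dl[OF conic[OF assms]], of r "(0, w)"] by simp
  ultimately show ?thesis using assms(2) by (simp add: power2_eq_square)
qed

text \<open>One more differentiation brings the degree down to zero; the vanishing of the Cartan
  tensor in the direction of the velocity rests on this.\<close>

lemma ddl_homogeneous:
  assumes "(x, y) \<in> \<Omega>" "r > 0"
  shows "ddl (x, r *\<^sub>R y) w (0, u) = ddl (x, y) w (0, u)"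
proof -
  have "\<forall>\<^sub>F t in nhds 0. dl (x, r *\<^sub>R y + t *\<^sub>R (r *\<^sub>R u)) (0, w) = r * dl (x, y + t *\<^sub>R u) (0, w)"
    using eventually_fibre_line[OF assms(1), of u]
    by eventually_elim (use dl_homogeneous[OF _ assms(2)] in \<open>force simp: scaleR_add_right mult.commute\<close>)
  moreover have "((\<lambda>t. dl (x, r *\<^sub>R y + t *\<^sub>R (r *\<^sub>R u)) (0, w)) has_real_derivative
      ddl (x, r *\<^sub>R y) w (0, r *\<^sub>R u)) (at 0)"
    using ddl_fibre_derivative[of x "r *\<^sub>R y" 0 "r *\<^sub>R u" w] conic[OF assms] by simp
  moreover have "((\<lambda>t. r * dl (x, y + t *\<^sub>R u) (0, w)) has_real_derivative r * ddl (x, y) w (0, u)) (at 0)"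
    using ddl_fibre_derivative[of x y 0 u w] assms(1) by (intro DERIV_cmult) simp
  ultimately have "ddl (x, r *\<^sub>R y) w (0, r *\<^sub>R u) = r * ddl (x, y) w (0, u)"
    by (rule has_real_derivative_eq_ev)
  moreover have "ddl (x, r *\<^sub>R y) w (0, r *\<^sub>R u) = r * ddl (x, r *\<^sub>R y) w (0, u)"
    using linear_cmul[OF linear_ddl[OF conic[OF assms], of w], of r "(0, u)"] by simp
  ultimately show ?thesis using assms(2) by simp
qed

text \<open>Euler's relation in degree two, from differentiating along the ray
  \<open>(1 + t) *\<^sub>R y\<close>.\<close>

lemma dl_euler:
  assumes "(x, y) \<in> \<Omega>"
  shows "dl (x, y) (0, y) = 2 * l (x, y)"
proof (rule has_real_derivative_eq_ev)
  show "\<forall>\<^sub>F t in nhds 0. l (x, y + t *\<^sub>R y) = (1 + t)\<^sup>2 * l (x, y)"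
    using eventually_scale_pos
    by eventually_elim (simp add: homogeneous[OF assms, symmetric] scaleR_left_distrib)
  show "((\<lambda>t. l (x, y + t *\<^sub>R y)) has_real_derivative dl (x, y) (0, y)) (at 0)"
    using dl_fibre_derivative[of x y 0 y] assms by simp
qed (auto intro!: derivative_eq_intros)

text \<open>Euler's relation in degree one, applied to the fibre derivative. It turns momentum into
  a first derivative of the Lagrangian.\<close>

lemma tensor_velocity_left:
  assumes "(x, y) \<in> \<Omega>"
  shows "tensor (x, y) y w = 1/2 * dl (x, y) (0, w)"
proof -
  have "ddl (x, y) w (0, y) = dl (x, y) (0, w)"
  proof (rule has_real_derivative_eq_ev)
    show "\<forall>\<^sub>F t in nhds 0. dl (x, y + t *\<^sub>R y) (0, w) = (1 + t) * dl (x, y) (0, w)"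
      using eventually_scale_pos
      by eventually_elim (simp add: dl_homogeneous[OF assms, symmetric] scaleR_left_distrib)
    show "((\<lambda>t. dl (x, y + t *\<^sub>R y) (0, w)) has_real_derivative ddl (x, y) w (0, y)) (at 0)"
      using ddl_fibre_derivative[of x y 0 y w] assms by simp
  qed (auto intro!: derivative_eq_intros)
  then show ?thesis using tensor_eq_ddl[OF assms] by simp
qed

lemma tensor_symmetric:
  assumes "(x, y) \<in> \<Omega>"
  shows "tensor (x, y) u w = tensor (x, y) w u"
  using second_frechet_derivative_symmetric[OF open_dom smooth assms, of "(0, w)" "(0, u)"]
  by (simp add: tensor_eq_ddl[OF assms])

text \<open>Euler's relation holds at all nearby base points with the same \<open>y\<close>, so it
  may be differentiated along the base.\<close>

lemma ddl_velocity_base: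
  assumes "(x, y) \<in> \<Omega>"
  shows "ddl (x, y) y (a, 0) = 2 * dl (x, y) (a, 0)"
proof (rule has_real_derivative_eq_ev)
  show "\<forall>\<^sub>F t in nhds 0. dl (x + t *\<^sub>R a, y) (0, y) = 2 * l (x + t *\<^sub>R a, y)"
    using eventually_line[OF assms, of "(a, 0)"] by eventually_elim (simp add: dl_euler)
  show "((\<lambda>t. dl (x + t *\<^sub>R a, y) (0, y)) has_real_derivative ddl (x, y) y (a, 0)) (at 0)"
    using smooth_on_line_derivative[OF smooth_on_frechet_derivative[OF smooth], of "(x, y)" 0 "(a, 0)"]
      assms by simp
  show "((\<lambda>t. 2 * l (x + t *\<^sub>R a, y)) has_real_derivative 2 * dl (x, y) (a, 0)) (at 0)"
    using smooth_on_line_derivative[OF smooth, of "(x, y)" 0 "(a, 0)"] assms by (intro DERIV_cmult) simp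
qed

lemma ddl_velocity_fibre: "(x, y) \<in> \<Omega> \<Longrightarrow> ddl (x, y) y (0, u) = dl (x, y) (0, u)"
  using tensor_symmetric[of x y u y] by (simp add: tensor_velocity_left tensor_eq_ddl[of x y u y])

end

section \<open>Transfer between the manifold and a chart\<close>

locale finsler_manifold = smooth_manifold A
  for A :: "('m::{t2_space, second_countable_topology}, 'e::euclidean_space) chart set" +
  fixes U :: "('m \<times> ('m, 'e) tvec) set" and L :: "'m \<times> ('m, 'e) tvec \<Rightarrow> real"
  assumes finsler: "conic_pseudo_finsler A U L"
begin

definition chart_dom :: "('m, 'e) chart \<Rightarrow> ('e \<times> 'e) set" where
  "chart_dom c = tchart c ` {v \<in> U. fst v \<in> cdom c}"

definition chart_lagrangian :: "('m, 'e) chart \<Rightarrow> 'e \<times> 'e \<Rightarrow> real" where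
  "chart_lagrangian c z = L (tchart_inv A c z)"

abbreviation chart_dl :: "('m, 'e) chart \<Rightarrow> 'e \<times> 'e \<Rightarrow> 'e \<times> 'e \<Rightarrow> real" where
  "chart_dl c z \<equiv> frechet_derivative (chart_lagrangian c) (at z)"

abbreviation chart_ddl :: "('m, 'e) chart \<Rightarrow> 'e \<times> 'e \<Rightarrow> 'e \<Rightarrow> 'e \<times> 'e \<Rightarrow> real" where
  "chart_ddl c z w \<equiv> frechet_derivative (\<lambda>z. chart_dl c z (0, w)) (at z)"

lemma conic_dom: "conic_domain A U"
  using finsler by (simp add: conic_pseudo_finsler_def)

lemma dom_tangent: "(p, \<xi>) \<in> U \<Longrightarrow> \<xi> \<in> tangent_space A p"
  using conic_dom unfolding conic_domain_def open_in_TM_def tangent_bundle_def by blast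

lemma tchart_inv_tchart:
  "\<xi> \<in> tangent_space A p \<Longrightarrow> c \<in> A \<Longrightarrow> p \<in> cdom c \<Longrightarrow> tchart_inv A c (cmap c p, \<xi> c) = (p, \<xi>)"
  by (simp add: tchart_inv_def cinv_cmap tvec_of_eq)

lemma chart_lagrangian_apply:
  "\<xi> \<in> tangent_space A p \<Longrightarrow> c \<in> A \<Longrightarrow> p \<in> cdom c \<Longrightarrow> chart_lagrangian c (cmap c p, \<xi> c) = L (p, \<xi>)"
  by (simp add: chart_lagrangian_def tchart_inv_tchart)

lemma chart_dom_memI: "(p, \<xi>) \<in> U \<Longrightarrow> p \<in> cdom c \<Longrightarrow> (cmap c p, \<xi> c) \<in> chart_dom c"
  by (force simp: chart_dom_def tchart_def)

lemma chart_domE: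
  assumes "z \<in> chart_dom c"
  obtains p \<xi> where "(p, \<xi>) \<in> U" "p \<in> cdom c" "z = (cmap c p, \<xi> c)"
  using assms by (auto simp: chart_dom_def tchart_def)

lemma conic_lagrangian_chart:
  assumes c: "c \<in> A"
  shows "conic_lagrangian (chart_dom c) (chart_lagrangian c)"
proof
  show "open (chart_dom c)"
    using conic_dom c by (auto simp: conic_domain_def open_in_TM_def chart_dom_def)
  show "smooth_on (chart_dom c) (chart_lagrangian c)"
    using finsler c unfolding conic_pseudo_finsler_def smooth_fun_on_TM_def chart_dom_def
      chart_lagrangian_def[abs_def] by blast
next
  fix x y :: 'e and r :: real
  assume "(x, y) \<in> chart_dom c" "r > 0"
  then obtain p \<xi> where v: "(p, \<xi>) \<in> U" "p \<in> cdom c" "x = cmap c p" "y = \<xi> c"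
    by (auto elim: chart_domE)
  have rv: "(p, r *\<^sub>T \<xi>) \<in> U" "L (p, r *\<^sub>T \<xi>) = r\<^sup>2 * L (p, \<xi>)"
    using finsler conic_dom v(1) \<open>r > 0\<close> unfolding conic_pseudo_finsler_def conic_domain_def
    by force+
  show "(x, r *\<^sub>R y) \<in> chart_dom c"
    using chart_dom_memI[OF rv(1) v(2)] v by (simp add: tscale_def)
  show "chart_lagrangian c (x, r *\<^sub>R y) = r\<^sup>2 * chart_lagrangian c (x, y)"
    using chart_lagrangian_apply[OF dom_tangent[OF rv(1)] c v(2)]
      chart_lagrangian_apply[OF dom_tangent[OF v(1)] c v(2)] rv(2) v(3,4) by (simp add: tscale_def)
qed

lemma fund_tensor_in_chart:
  assumes "\<xi> \<in> tangent_space A p" "u \<in> tangent_space A p" "w \<in> tangent_space A p" "c \<in> A" "p \<in> cdom c"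
  shows "fund_tensor L (p, \<xi>) u w =
    conic_lagrangian.tensor (chart_lagrangian c) (cmap c p, \<xi> c) (u c) (w c)"
proof -
  have "L (p, \<xi> +\<^sub>T t *\<^sub>T u +\<^sub>T s *\<^sub>T w) = chart_lagrangian c (cmap c p, \<xi> c + t *\<^sub>R u c + s *\<^sub>R w c)" for t s
    using chart_lagrangian_apply[of "\<xi> +\<^sub>T t *\<^sub>T u +\<^sub>T s *\<^sub>T w" p c] assms
    by (simp add: tangent_space_add tangent_space_scale) (simp add: tadd_def tscale_def)
  then show ?thesis
    unfolding fund_tensor_def conic_lagrangian.tensor_def[OF conic_lagrangian_chart[OF assms(4)]] by simp
qed

lemma fund_tensor_eq:
  assumes "(p, \<xi>) \<in> U" "u \<in> tangent_space A p" "w \<in> tangent_space A p" "c \<in> A" "p \<in> cdom c"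
  shows "fund_tensor L (p, \<xi>) u w = 1/2 * chart_ddl c (cmap c p, \<xi> c) (w c) (0, u c)"
  using fund_tensor_in_chart[OF dom_tangent[OF assms(1)] assms(2-5)]
    conic_lagrangian.tensor_eq_ddl[OF conic_lagrangian_chart[OF assms(4)] chart_dom_memI[OF assms(1,5)]]
  by simp

lemma fund_tensor_velocity_left:
  assumes "(p, \<xi>) \<in> U" "w \<in> tangent_space A p" "c \<in> A" "p \<in> cdom c"
  shows "fund_tensor L (p, \<xi>) \<xi> w = 1/2 * chart_dl c (cmap c p, \<xi> c) (0, w c)"
  using fund_tensor_in_chart[OF dom_tangent[OF assms(1)] dom_tangent[OF assms(1)] assms(2-4)]
    conic_lagrangian.tensor_velocity_left[OF conic_lagrangian_chart[OF assms(3)] chart_dom_memI[OF assms(1,4)]]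
  by simp

text \<open>The first slot is the direction of differentiation. Along the ray through \<xi> the
  fundamental tensor is constant, being homogeneous of degree zero.\<close>

lemma cartan_tensor_velocity:
  assumes "(p, \<xi>) \<in> U" "u \<in> tangent_space A p" "w \<in> tangent_space A p"
  shows "cartan_tensor L (p, \<xi>) \<xi> u w = 0"
proof -
  obtain c where c: "c \<in> A" "p \<in> cdom c" using chart_at_mem mem_chart_at by blast
  interpret F: conic_lagrangian "chart_dom c" "chart_lagrangian c"
    by (rule conic_lagrangian_chart[OF c(1)])
  have "\<forall>\<^sub>F t in nhds 0. fund_tensor L (p, \<xi> +\<^sub>T t *\<^sub>T \<xi>) u w = fund_tensor L (p, \<xi>) u w"
    using eventually_scale_pos
  proof eventually_elim
    fix t :: real assume t: "1 + t > 0"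
    have eq: "\<xi> +\<^sub>T t *\<^sub>T \<xi> = (1 + t) *\<^sub>T \<xi>"
      by (auto simp: tadd_def tscale_def scaleR_left_distrib)
    have "(p, (1 + t) *\<^sub>T \<xi>) \<in> U"
      using conic_dom assms(1) t unfolding conic_domain_def by force
    then show "fund_tensor L (p, \<xi> +\<^sub>T t *\<^sub>T \<xi>) u w = fund_tensor L (p, \<xi>) u w"
      unfolding eq
      using fund_tensor_eq[OF _ assms(2,3) c, of "(1 + t) *\<^sub>T \<xi>"] fund_tensor_eq[OF assms c]
        F.ddl_homogeneous[OF chart_dom_memI[OF assms(1) c(2)] t] by (simp add: tscale_def)
  qed
  then have "deriv (\<lambda>t. fund_tensor L (p, \<xi> +\<^sub>T t *\<^sub>T \<xi>) u w) 0 = deriv (\<lambda>t::real. fund_tensor L (p, \<xi>) u w) 0"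
    by (rule deriv_cong_ev) simp
  then show ?thesis by (simp add: cartan_tensor_def)
qed

end


section \<open>The Chern connection in a chart\<close>

locale chern_manifold = finsler_manifold A U L
  for A :: "('m::{t2_space, second_countable_topology}, 'e::euclidean_space) chart set" and U L +
  fixes nabla :: "('m, 'e) aniso_conn"
  assumes chern: "chern_connection A U L nabla"
begin

text \<open>Extends the Christoffel symbols bilinearly from basis vectors to arbitrary lower slots.\<close>

definition christoffel_map ::
  "('m, 'e) chart \<Rightarrow> 'm \<times> ('m, 'e) tvec \<Rightarrow> 'e \<Rightarrow> 'e \<Rightarrow> 'e" where
  "christoffel_map c v a b = nabla v (coord_field A c a) (coord_field A c b) c"

lemma connection: "aniso_connection A U nabla"
  and torsion_free:
    "open W \<Longrightarrow> vector_field_on A W X \<Longrightarrow> vector_field_on A W Y \<Longrightarrow> v \<in> U \<Longrightarrow> fst v \<in> W \<Longrightarrow>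
      nabla v X Y -\<^sub>T nabla v Y X = lie_bracket A X Y (fst v)"
  and metric_compatible:
    "open W \<Longrightarrow> vector_field_on A W Y0 \<Longrightarrow> (\<And>p. p \<in> W \<Longrightarrow> (p, Y0 p) \<in> U) \<Longrightarrow>
      vector_field_on A W X \<Longrightarrow> vector_field_on A W Y \<Longrightarrow> vector_field_on A W Z \<Longrightarrow> p \<in> W \<Longrightarrow>
      tdiff A (\<lambda>q. fund_tensor L (q, Y0 q) (Y q) (Z q)) p (X p) =
             fund_tensor L (p, Y0 p) (nabla (p, Y0 p) X Y) (Z p)
           + fund_tensor L (p, Y0 p) (Y p) (nabla (p, Y0 p) X Z)
           + 2 * cartan_tensor L (p, Y0 p) (Y p) (Z p) (nabla (p, Y0 p) X Y0)"
  using chern unfolding chern_connection_def by blast+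

lemma nabla_tangent:
  assumes "open W" "vector_field_on A W X" "vector_field_on A W Y" "(p, \<xi>) \<in> U" "p \<in> W"
  shows "nabla (p, \<xi>) X Y \<in> tangent_space A p"
proof -
  have "aniso_vector_field A {v \<in> U. fst v \<in> W} (\<lambda>v. nabla v X Y)"
    using connection assms unfolding aniso_connection_def by blast
  then show ?thesis using assms unfolding aniso_vector_field_def by force
qed

text \<open>The axioms of the connection speak of reference fields, not of single vectors. The field
  with the constant components of \<xi> extends it and, the domain being open, stays in
  \<open>U\<close> near \<open>p\<close>.\<close>

lemma coord_reference_field:
  assumes "(p, \<xi>) \<in> U" and c: "c \<in> A" "p \<in> cdom c"
  obtains W where "open W" "p \<in> W" "W \<subseteq> cdom c" "coord_field A c (\<xi> c) p = \<xi>"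
    "\<And>q. q \<in> W \<Longrightarrow> (q, coord_field A c (\<xi> c) q) \<in> U"
proof
  interpret F: conic_lagrangian "chart_dom c" "chart_lagrangian c"
    by (rule conic_lagrangian_chart[OF c(1)])
  let ?W = "cdom c \<inter> (\<lambda>q. (cmap c q, \<xi> c)) -` chart_dom c"
  show "open ?W"
    by (rule continuous_open_preimage[OF _ open_cdom[OF c(1)] F.open_dom])
      (intro continuous_intros continuous_on_cmap c)
  show "p \<in> ?W" using chart_dom_memI assms by auto
  show "coord_field A c (\<xi> c) p = \<xi>"
    using tvec_of_eq[OF dom_tangent] assms by (simp add: coord_field_def)
  show "(q, coord_field A c (\<xi> c) q) \<in> U" if "q \<in> ?W" for q
  proof -
    \<comment> \<open>A point of \<open>chart_dom c\<close> comes from a vector of \<open>U\<close>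
      over some \<open>p'\<close>; injectivity of the chart gives \<open>p' = q\<close>.\<close>
    obtain p' \<eta> where v: "(p', \<eta>) \<in> U" "p' \<in> cdom c" "cmap c q = cmap c p'" "\<xi> c = \<eta> c"
      using \<open>q \<in> ?W\<close> by (auto elim: chart_domE)
    then have "p' = q" using \<open>q \<in> ?W\<close> cinv_cmap[OF c(1)] by (metis IntD1)
    then show ?thesis using v tvec_of_eq[OF dom_tangent[OF v(1)] c(1) v(2)] by (simp add: coord_field_def)
  qed
qed auto

text \<open>Inherited from the linear connection of a local reference field. Coordinate fields add
  and scale correctly on \<open>W\<close>, so each identity first replaces the field by one agreeing
  with it there.\<close>

lemma linear_christoffel_map:
  assumes "(p, \<xi>) \<in> U" and c: "c \<in> A" "p \<in> cdom c"
  shows "linear (\<lambda>a. christoffel_map c (p, \<xi>) a b)" "linear (\<lambda>b. christoffel_map c (p, \<xi>) a b)"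
proof -
  obtain W where W: "open W" "p \<in> W" "W \<subseteq> cdom c" "coord_field A c (\<xi> c) p = \<xi>"
    "\<And>q. q \<in> W \<Longrightarrow> (q, coord_field A c (\<xi> c) q) \<in> U"
    using coord_reference_field[OF assms] by blast
  define D where "D = (\<lambda>X Y q. nabla (q, coord_field A c (\<xi> c) q) X Y)"
  have vf: "vector_field_on A W (coord_field A c a)" for a
    by (rule coord_field_vector_field[OF c(1) W(1,3)])
  have "linear_connection_on A W D"
    unfolding D_def using connection W(1,5) vf unfolding aniso_connection_def by blast
  note lc = this[unfolded linear_connection_on_def]
  note cong = lc[THEN conjunct2, THEN conjunct1, rule_format, OF _ W(2)]
  note add1 = lc[THEN conjunct2, THEN conjunct2, THEN conjunct1, rule_format, OF _ W(2)]
  note scale1 = lc[THEN conjunct2, THEN conjunct2, THEN conjunct2, THEN conjunct1, rule_format, OF _ W(2)]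
  note add2 = lc[THEN conjunct2, THEN conjunct2, THEN conjunct2, THEN conjunct2, THEN conjunct1,
      rule_format, OF _ W(2)]
  note scale2 = lc[THEN conjunct2, THEN conjunct2, THEN conjunct2, THEN conjunct2, THEN conjunct2,
      rule_format, OF _ W(2)]
  have G: "christoffel_map c (p, \<xi>) a b = D (coord_field A c a) (coord_field A c b) p c" for a b
    by (simp add: christoffel_map_def D_def W(4))
  have coord_add: "coord_field A c (a + a') q = coord_field A c a q +\<^sub>T coord_field A c a' q"
    if "q \<in> W" for a a' q
    using that W(3) tvec_of_add[OF c(1)] by (auto simp: coord_field_def)
  have coord_scale: "coord_field A c (r *\<^sub>R a) q = r *\<^sub>T coord_field A c a q" if "q \<in> W" for r a q
    using that W(3) tvec_of_scale[OF c(1)] by (auto simp: coord_field_def)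
  have const: "smooth_fun_on A W (\<lambda>q. r)" for r
    by (simp add: smooth_fun_on_def smooth_on_const)
  show "linear (\<lambda>a. christoffel_map c (p, \<xi>) a b)"
  proof
    fix a a' :: 'e and r :: real
    have "D (coord_field A c (a + a')) (coord_field A c b) p =
        D (\<lambda>q. coord_field A c a q +\<^sub>T coord_field A c a' q) (coord_field A c b) p"
      by (rule cong) (auto simp: vf coord_add)
    then show "christoffel_map c (p, \<xi>) (a + a') b = christoffel_map c (p, \<xi>) a b + christoffel_map c (p, \<xi>) a' b"
      using add1[of "coord_field A c a" "coord_field A c a'" "coord_field A c b"] vf
      by (simp add: G tadd_def)
    have "D (coord_field A c (r *\<^sub>R a)) (coord_field A c b) p =
        D (\<lambda>q. r *\<^sub>T coord_field A c a q) (coord_field A c b) p"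
      by (rule cong) (auto simp: vf coord_scale)
    then show "christoffel_map c (p, \<xi>) (r *\<^sub>R a) b = r *\<^sub>R christoffel_map c (p, \<xi>) a b"
      using scale1[of "\<lambda>q. r" "coord_field A c a" "coord_field A c b"] vf const
      by (simp add: G tscale_def)
  qed
  show "linear (\<lambda>b. christoffel_map c (p, \<xi>) a b)"
  proof
    fix b b' :: 'e and r :: real
    have "D (coord_field A c a) (coord_field A c (b + b')) p =
        D (coord_field A c a) (\<lambda>q. coord_field A c b q +\<^sub>T coord_field A c b' q) p"
      by (rule cong) (auto simp: vf coord_add)
    then show "christoffel_map c (p, \<xi>) a (b + b') = christoffel_map c (p, \<xi>) a b + christoffel_map c (p, \<xi>) a b'"
      using add2[of "coord_field A c a" "coord_field A c b" "coord_field A c b'"] vf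
      by (simp add: G tadd_def)
    have "D (coord_field A c a) (coord_field A c (r *\<^sub>R b)) p =
        D (coord_field A c a) (\<lambda>q. r *\<^sub>T coord_field A c b q) p"
      by (rule cong) (auto simp: vf coord_scale)
    \<comment> \<open>The scalar is a constant function, so the derivative term of the Leibniz rule
      vanishes.\<close>
    then show "christoffel_map c (p, \<xi>) a (r *\<^sub>R b) = r *\<^sub>R christoffel_map c (p, \<xi>) a b"
      using scale2[of "\<lambda>q. r" "coord_field A c a" "coord_field A c b"] vf const
      by (simp add: G tscale_def tadd_def tdiff_def Let_def)
  qed
qed

text \<open>Coordinate fields have constant components in their own chart and hence commute, so
  vanishing torsion is symmetry of the lower slots.\<close>

lemma christoffel_map_symmetric:
  assumes "(p, \<xi>) \<in> U" and c: "c \<in> A" "p \<in> cdom c"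
  shows "christoffel_map c (p, \<xi>) a b = christoffel_map c (p, \<xi>) b a"
proof -
  have vf: "vector_field_on A (cdom c) (coord_field A c a)" for a
    by (rule coord_field_vector_field[OF c(1) open_cdom[OF c(1)]]) auto
  have "((\<lambda>x. coord_field A c a (cinv c x) c) has_derivative (\<lambda>h. 0)) (at (cmap c p))" for a
    by (rule has_derivative_transform_within_open[OF has_derivative_const open_cmap_cdom[OF c(1)]])
      (use c in \<open>auto simp: cinv_cmap coord_field_def tvec_of_component\<close>)
  from frechet_derivative_at[OF this]
  have "frechet_derivative (\<lambda>x. coord_field A c a (cinv c x) c) (at (cmap c p)) = (\<lambda>h. 0)" for a
    by simp
  then have "lie_bracket A (coord_field A c a) (coord_field A c b) p c = 0"
    by (simp add: lie_bracket_def)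
  with fun_cong[OF torsion_free[OF open_cdom[OF c(1)] vf vf assms(1), of a b], of c] c(2) show ?thesis
    by (simp add: christoffel_map_def tminus_def)
qed

text \<open>The reference field also serves as the first argument of the metric. This reduces the
  tensor on the left to half a fibre derivative and kills the Cartan term. The chart is
  \<open>chart_at A p\<close> because \<open>tdiff\<close> is computed there.\<close>

lemma metric_compatible_in_chart:
  assumes "(p, \<xi>) \<in> U" and c: "c = chart_at A p" and z: "z = (cmap c p, \<xi> c)"
  shows "chart_ddl c z d (a, 0) =
    chart_ddl c z d (0, christoffel_map c (p, \<xi>) a (\<xi> c)) + chart_dl c z (0, christoffel_map c (p, \<xi>) a d)"
proof -
  have cA: "c \<in> A" "p \<in> cdom c" using chart_at_mem mem_chart_at c by auto
  interpret F: conic_lagrangian "chart_dom c" "chart_lagrangian c"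
    by (rule conic_lagrangian_chart[OF cA(1)])
  let ?y = "\<xi> c" and ?X = "coord_field A c"
  obtain W where W: "open W" "p \<in> W" "W \<subseteq> cdom c" "?X ?y p = \<xi>" "\<And>q. q \<in> W \<Longrightarrow> (q, ?X ?y q) \<in> U"
    using coord_reference_field[OF assms(1) cA] by blast
  have vf: "vector_field_on A W (?X a)" for a
    by (rule coord_field_vector_field[OF cA(1) W(1,3)])
  have coord: "?X a q c = a" "?X a q \<in> tangent_space A q" if "q \<in> W" for a q
    using that W(3) cA by (auto simp: coord_field_def tvec_of_component tvec_of_in_tangent_space)
  have zdom: "z \<in> chart_dom c" using chart_dom_memI[OF assms(1) cA(2)] z by simp
  have "((\<lambda>x. (x, ?y)) has_derivative (\<lambda>h. (h, 0))) (at (cmap c p))"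
    by (auto intro!: derivative_eq_intros)
  from has_derivative_compose[OF this, of "\<lambda>z. chart_dl c z (0, d)"]
  have "((\<lambda>x. chart_dl c (x, ?y) (0, d)) has_derivative (\<lambda>h. chart_ddl c z d (h, 0))) (at (cmap c p))"
    using F.has_derivative_ddl[OF zdom] z by simp
  then have "((\<lambda>x. 1/2 * chart_dl c (x, ?y) (0, d)) has_derivative (\<lambda>h. 1/2 * chart_ddl c z d (h, 0))) (at (cmap c p))"
    by (rule has_derivative_mult_right)
  \<comment> \<open>Identifies the function that \<open>tdiff\<close> differentiates with half the
    fibre derivative at constant velocity \<open>?y\<close>, near the point.\<close>
  then have "((\<lambda>x. fund_tensor L (cinv c x, ?X ?y (cinv c x)) (?X ?y (cinv c x)) (?X d (cinv c x)))
      has_derivative (\<lambda>h. 1/2 * chart_ddl c z d (h, 0))) (at (cmap c p))"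
  proof (rule has_derivative_transform_within_open)
    show "open (cmap c ` (W \<inter> cdom c))" by (rule open_cmap_image[OF cA(1) W(1)])
    show "cmap c p \<in> cmap c ` (W \<inter> cdom c)" using W cA by auto
    fix x assume "x \<in> cmap c ` (W \<inter> cdom c)"
    then obtain q where q: "q \<in> W" "q \<in> cdom c" "x = cmap c q" by auto
    show "1/2 * chart_dl c (x, ?y) (0, d) =
        fund_tensor L (cinv c x, ?X ?y (cinv c x)) (?X ?y (cinv c x)) (?X d (cinv c x))"
      using fund_tensor_velocity_left[OF W(5)[OF q(1)] coord(2)[OF q(1), of d] cA(1) q(2)] q cA
      by (simp add: cinv_cmap coord)
  qed
  from fun_cong[OF frechet_derivative_at[OF this], of a]
  have "tdiff A (\<lambda>q. fund_tensor L (q, ?X ?y q) (?X ?y q) (?X d q)) p (?X a p) = 1/2 * chart_ddl c z d (a, 0)"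
    using coord(1)[OF W(2)] by (simp add: tdiff_def c[symmetric])
  moreover have N: "nabla (p, \<xi>) (?X a) (?X b) \<in> tangent_space A p" for b
    by (rule nabla_tangent[OF W(1) vf vf assms(1) W(2)])
  moreover have "fund_tensor L (p, \<xi>) (nabla (p, \<xi>) (?X a) (?X ?y)) (?X d p) =
      1/2 * chart_ddl c z d (0, christoffel_map c (p, \<xi>) a ?y)"
    using fund_tensor_eq[OF assms(1) N coord(2)[OF W(2)] cA] coord(1)[OF W(2)]
    by (simp add: z christoffel_map_def)
  moreover have "fund_tensor L (p, \<xi>) \<xi> (nabla (p, \<xi>) (?X a) (?X d)) =
      1/2 * chart_dl c z (0, christoffel_map c (p, \<xi>) a d)"
    using fund_tensor_velocity_left[OF assms(1) N cA] by (simp add: z christoffel_map_def)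
  moreover have "cartan_tensor L (p, \<xi>) \<xi> (?X d p) (nabla (p, \<xi>) (?X a) (?X ?y)) = 0"
    by (rule cartan_tensor_velocity[OF assms(1) coord(2)[OF W(2)] N])
  ultimately show ?thesis
    using metric_compatible[OF W(1) vf[of ?y] W(5) vf[of a] vf[of ?y] vf[of d] W(2)] by (simp add: W(4))
qed

text \<open>Compatibility with \<open>d\<close> equal to the velocity: by Euler's relations the left
  side is twice the base derivative, and both terms on the right equal the same fibre derivative.
  Symmetry then exchanges the lower slots.\<close>

lemma chart_dl_christoffel:
  assumes "(p, \<xi>) \<in> U" and c: "c = chart_at A p" and z: "z = (cmap c p, \<xi> c)"
  shows "chart_dl c z (0, christoffel_map c (p, \<xi>) (\<xi> c) a) = chart_dl c z (a, 0)"
proof -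
  have cA: "c \<in> A" "p \<in> cdom c" using chart_at_mem mem_chart_at c by auto
  interpret F: conic_lagrangian "chart_dom c" "chart_lagrangian c"
    by (rule conic_lagrangian_chart[OF cA(1)])
  note zdom = chart_dom_memI[OF assms(1) cA(2)]
  show ?thesis
    using metric_compatible_in_chart[OF assms, of "\<xi> c" a] christoffel_map_symmetric[OF assms(1) cA, of "\<xi> c" a]
      F.ddl_velocity_base[OF zdom] F.ddl_velocity_fibre[OF zdom] z by simp
qed

text \<open>The double sum in \<open>cov_deriv\<close> is the expansion of the bilinear
  \<open>christoffel_map\<close> over basis vectors.\<close>

lemma cov_deriv_component:
  assumes v: "lift A I \<gamma> t \<in> U" and c: "c = chart_at A (\<gamma> t)"
  shows "cov_deriv A nabla I \<gamma> X t c =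
      vector_derivative (\<lambda>s. X s c) (at t within I) +
      christoffel_map c (lift A I \<gamma> t) (velocity A I \<gamma> t c) (X t c)"
    and "cov_deriv A nabla I \<gamma> X t \<in> tangent_space A (\<gamma> t)"
proof -
  have cA: "c \<in> A" "\<gamma> t \<in> cdom c" using chart_at_mem mem_chart_at c by auto
  show "cov_deriv A nabla I \<gamma> X t \<in> tangent_space A (\<gamma> t)"
    by (simp add: cov_deriv_def Let_def tvec_of_in_tangent_space chart_at_mem mem_chart_at)
  let ?G = "christoffel_map c (lift A I \<gamma> t)" and ?y = "velocity A I \<gamma> t c"
  have lin: "linear (\<lambda>a. ?G a b)" "linear (\<lambda>b. ?G a b)" for a b
    using linear_christoffel_map[of "\<gamma> t" "velocity A I \<gamma> t" c] v cA by (simp_all add: lift_def)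
  have "?G ?y (X t c) = (\<Sum>i\<in>Basis. (?y \<bullet> i) *\<^sub>R ?G i (X t c))"
    by (rule linear_euclidean_expansion[OF lin(1)])
  also have "\<dots> = (\<Sum>i\<in>Basis. (?y \<bullet> i) *\<^sub>R (\<Sum>j\<in>Basis. (X t c \<bullet> j) *\<^sub>R ?G i j))"
    by (intro sum.cong refl arg_cong2[where f = scaleR] linear_euclidean_expansion[OF lin(2)])
  finally have "?G ?y (X t c) = \<dots>" .
  then have G: "(\<Sum>i\<in>Basis. \<Sum>j\<in>Basis. christoffel A nabla c (lift A I \<gamma> t) i j k * (?y \<bullet> i) * (X t c \<bullet> j)) =
      ?G ?y (X t c) \<bullet> k" for k
    by (simp add: inner_sum_left christoffel_def christoffel_map_def sum_distrib_left mult_ac)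
  show "cov_deriv A nabla I \<gamma> X t c = vector_derivative (\<lambda>s. X s c) (at t within I) + ?G ?y (X t c)"
    unfolding cov_deriv_def Let_def c[symmetric] tvec_of_component[OF cA] G
    by (simp add: inner_add_left[symmetric] euclidean_representation)
qed

end


section \<open>Killing fields and momentum\<close>

context finsler_manifold
begin

text \<open>The component \<open>DV y\<close> arises as the time derivative of the space derivative of the flow, by
  interchanging the two derivatives.\<close>

lemma killing_in_chart:
  assumes "killing A U L V" and v: "(p, \<xi>) \<in> U" and c: "c = chart_at A p"
  shows "chart_dl c (cmap c p, \<xi> c)
    (V p c, frechet_derivative (\<lambda>x. V (cinv c x) c) (at (cmap c p)) (\<xi> c)) = 0"
proof -
  have cA: "c \<in> A" "p \<in> cdom c" using chart_at_mem mem_chart_at c by auto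
  interpret F: conic_lagrangian "chart_dom c" "chart_lagrangian c"
    by (rule conic_lagrangian_chart[OF cA(1)])
  obtain E \<Phi> where V: "vector_field_on A UNIV V" and flow: "flow_of A V E \<Phi>"
    and inv: "\<And>s. (s, p) \<in> E \<Longrightarrow> (\<Phi> s p, tmap A (\<Phi> s) p \<xi>) \<in> U"
      "\<And>s. (s, p) \<in> E \<Longrightarrow> L (\<Phi> s p, tmap A (\<Phi> s) p \<xi>) = L (p, \<xi>)"
    using assms(1) v unfolding killing_def by blast
  \<comment> \<open>The part of the flow domain on which start and end point both lie in the chart;
    \<psi> is the flow in coordinates.\<close>
  define S where "S = {(s, x). x \<in> cmap c ` cdom c \<and> (s, cinv c x) \<in> E \<and> \<Phi> s (cinv c x) \<in> cdom c}"
  define \<psi> where "\<psi> = (\<lambda>(s, x). cmap c (\<Phi> s (cinv c x)))"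
  define X where "X = (\<lambda>x. V (cinv c x) c)"
  let ?D = "\<lambda>z. frechet_derivative \<psi> (at z)"
  let ?x = "cmap c p" and ?y = "\<xi> c"
  have "open S \<and> smooth_on S \<psi>"
    using flow cA(1) unfolding flow_of_def Let_def S_def \<psi>_def by blast
  then have oS: "open S" and \<psi>: "smooth_on S \<psi>" by auto
  have X: "smooth_on (cmap c ` cdom c) X"
    using vector_field_component_smooth[OF V cA(1)] by (simp add: X_def)
  have E0: "(0, q) \<in> E" "\<Phi> 0 q = q" for q
    using flow by (auto simp: flow_of_def)
  have S0: "(0, x) \<in> S \<and> \<psi> (0, x) = x" if "x \<in> cmap c ` cdom c" for x
    using that cA by (auto simp: S_def \<psi>_def E0 cinv_cmap)
  have x: "?x \<in> cmap c ` cdom c" using cA by auto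
  have time: "((\<lambda>r. (r, x)) has_vector_derivative (1, 0)) (at s)" for s :: real and x :: 'e
    by (auto simp: has_vector_derivative_def intro!: derivative_eq_intros)
  have space: "((\<lambda>x. (s, x)) has_derivative (\<lambda>h. (0, h))) (at x)" for s :: real and x :: 'e
    by (auto intro!: derivative_eq_intros)
  have flow_eq: "?D z (1, 0) = X (\<psi> z)" if "z \<in> S" for z
  proof -
    obtain s x where z: "z = (s, x)" by force
    let ?q = "cinv c x" and ?J = "{r. (r, cinv c x) \<in> E}"
    have s: "s \<in> ?J" "\<Phi> s ?q \<in> cdom c" using that by (auto simp: z S_def)
    have "open ((\<lambda>r. (r, ?q)) -` E)"
      using flow by (intro open_vimage continuous_intros) (simp add: flow_of_def)
    \<comment> \<open>Openness turns the derivative within \<open>?J\<close>, by which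
      \<open>velocity\<close> is defined, into the ordinary one.\<close>
    then have J: "open ?J" by (simp add: vimage_def)
    have "velocity A ?J (\<lambda>r. \<Phi> r ?q) s = V (\<Phi> s ?q)"
      using flow[unfolded flow_of_def, THEN conjunct2, THEN conjunct2, THEN conjunct1, rule_format, of ?q]
        s(1) unfolding integral_curve_def by blast
    from fun_cong[OF this, of c] have "vector_derivative (\<lambda>r. \<psi> (r, x)) (at s) = X (\<psi> z)"
      using at_within_open[OF s(1) J] s(2) cA(1)
      by (simp add: velocity_def \<psi>_def X_def z cinv_cmap)
    moreover have "((\<lambda>r. \<psi> (r, x)) has_vector_derivative ?D z (1, 0)) (at s)"
      using has_vector_derivative_compose_frechet[OF \<psi> _ time] that z by simp
    ultimately show ?thesis by (simp add: vector_derivative_at)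
  qed
  have D0: "?D (0, ?x) (0, h) = h" for h
  proof -
    have "((\<lambda>x. \<psi> (0, x)) has_derivative (\<lambda>h. ?D (0, ?x) (0, h))) (at ?x)"
      using has_derivative_compose[OF space smooth_on_has_derivative[OF \<psi>]] S0[OF x] by simp
    then have "((\<lambda>x. x) has_derivative (\<lambda>h. ?D (0, ?x) (0, h))) (at ?x)"
      by (rule has_derivative_transform_within_open[OF _ open_cmap_cdom[OF cA(1)] x]) (use S0 in blast)
    from fun_cong[OF frechet_derivative_at[OF this], of h] show ?thesis by simp
  qed
  \<comment> \<open>At time 0 the time derivative of \<psi> is \<open>X\<close> throughout the
    chart, so its space derivative is that of \<open>X\<close>; Schwarz's theorem exchanges the
    order.\<close>
  have mixed: "frechet_derivative (\<lambda>z. ?D z (0, ?y)) (at (0, ?x)) (1, 0) = frechet_derivative X (at ?x) ?y"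
  proof -
    have "((\<lambda>x. ?D (0, x) (1, 0)) has_derivative
        (\<lambda>h. frechet_derivative (\<lambda>z. ?D z (1, 0)) (at (0, ?x)) (0, h))) (at ?x)"
      using has_derivative_compose[OF space smooth_on_has_derivative[OF smooth_on_frechet_derivative[OF \<psi>]]]
        S0[OF x] by simp
    then have "(X has_derivative
        (\<lambda>h. frechet_derivative (\<lambda>z. ?D z (1, 0)) (at (0, ?x)) (0, h))) (at ?x)"
      by (rule has_derivative_transform_within_open[OF _ open_cmap_cdom[OF cA(1)] x])
        (use S0 flow_eq in auto)
    from fun_cong[OF frechet_derivative_at[OF this], of ?y] show ?thesis
      using second_frechet_derivative_symmetric[OF oS \<psi>, of "(0, ?x)" "(0, ?y)" "(1, 0)"] S0[OF x] by simp
  qed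
  \<comment> \<open>The path of \<xi> under the differentials of the flow, in the induced chart of
    the tangent bundle. Its initial velocity is the complete lift of \<open>V\<close>.\<close>
  let ?z = "\<lambda>s. (\<psi> (s, ?x), ?D (s, ?x) (0, ?y))"
  have z0: "?z 0 = (?x, ?y)" using S0[OF x] D0 by simp
  have "(?z has_vector_derivative (X ?x, frechet_derivative X (at ?x) ?y)) (at 0)"
  proof (rule has_vector_derivative_Pair)
    show "((\<lambda>s. \<psi> (s, ?x)) has_vector_derivative X ?x) (at 0)"
      using has_vector_derivative_compose_frechet[OF \<psi> _ time] S0[OF x] flow_eq by metis
    show "((\<lambda>s. ?D (s, ?x) (0, ?y)) has_vector_derivative frechet_derivative X (at ?x) ?y) (at 0)"
      using has_vector_derivative_compose_frechet[OF smooth_on_frechet_derivative[OF \<psi>] _ time] S0[OF x] mixed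
      by metis
  qed
  then have "((\<lambda>s. chart_lagrangian c (?z s)) has_vector_derivative
      chart_dl c (?x, ?y) (X ?x, frechet_derivative X (at ?x) ?y)) (at 0)"
    using has_vector_derivative_compose_frechet[OF F.smooth, of ?z 0 _ UNIV] chart_dom_memI[OF v cA(2)]
    unfolding z0 by blast
  then have deriv: "((\<lambda>s. chart_lagrangian c (?z s)) has_real_derivative
      chart_dl c (?x, ?y) (X ?x, frechet_derivative X (at ?x) ?y)) (at 0)"
    by (simp add: has_real_derivative_iff_has_vector_derivative)
  have "chart_lagrangian c (?z s) = L (p, \<xi>)" if s: "(s, ?x) \<in> S" for s
  proof -
    have sE: "(s, p) \<in> E" "\<Phi> s p \<in> cdom c" using s cA by (auto simp: S_def cinv_cmap)
    have "((\<lambda>x. \<psi> (s, x)) has_derivative (\<lambda>h. ?D (s, ?x) (0, h))) (at ?x)"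
      by (rule has_derivative_compose[OF space smooth_on_has_derivative[OF \<psi> s]])
    from fun_cong[OF frechet_derivative_at[OF this], of ?y]
    have "tmap A (\<Phi> s) p \<xi> c = ?D (s, ?x) (0, ?y)"
      using sE cA(1) by (simp add: tmap_def Let_def c[symmetric] \<psi>_def)
    moreover have "cmap c (\<Phi> s p) = \<psi> (s, ?x)" using cA by (simp add: \<psi>_def cinv_cmap)
    ultimately show ?thesis
      using chart_lagrangian_apply[OF dom_tangent[OF inv(1)[OF sE(1)]] cA(1) sE(2)] inv(2)[OF sE(1)] by simp
  qed
  \<comment> \<open>Only for short times is the flow line sure to remain in the chart, which
    suffices for a derivative at 0.\<close>
  moreover have "\<forall>\<^sub>F s in nhds 0. (s, ?x) \<in> S"
  proof -
    have "((\<lambda>s. (s, ?x)) \<longlongrightarrow> (0, ?x)) (nhds (0::real))"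
      by (intro tendsto_intros filterlim_ident)
    then show ?thesis using oS S0[OF x] topological_tendstoD by blast
  qed
  ultimately have "\<forall>\<^sub>F s in nhds 0. chart_lagrangian c (?z s) = L (p, \<xi>)"
    by (auto elim: eventually_mono)
  from has_real_derivative_eq_ev[OF this deriv DERIV_const]
  have "chart_dl c (?x, ?y) (X ?x, frechet_derivative X (at ?x) ?y) = 0" .
  then show ?thesis using cA by (simp add: X_def cinv_cmap)
qed

end

section \<open>Momentum of a Killing field along an admissible curve\<close>

context chern_manifold
begin

context
  fixes V :: "'m \<Rightarrow> ('m, 'e) tvec" and I :: "real set" and \<gamma> :: "real \<Rightarrow> 'm" and t :: real
  assumes killing: "killing A U L V"
    and admissible: "admissible_curve A U I \<gamma>"
    and t: "t \<in> I"
begin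

text \<open>The chart is frozen at time \<open>t\<close>: \<open>chart_at A (\<gamma> s)\<close> may
  jump as \<open>s\<close> varies, so derivatives at \<open>t\<close> are taken in the chart chosen
  for \<open>\<gamma> t\<close>.\<close>

private abbreviation (input) "c \<equiv> chart_at A (\<gamma> t)"
private abbreviation (input) "x \<equiv> cmap c (\<gamma> t)"
private abbreviation (input) "y \<equiv> velocity A I \<gamma> t c"
private abbreviation (input) "X \<equiv> \<lambda>x. V (cinv c x) c"
private abbreviation (input) "DX \<equiv> frechet_derivative X (at x) y"

private lemma curve: "smooth_curve A I \<gamma>" and lift: "s \<in> I \<Longrightarrow> (\<gamma> s, velocity A I \<gamma> s) \<in> U"
  using admissible by (auto simp: admissible_curve_def lift_def)

private lemma V_field: "vector_field_on A UNIV V" and V_tangent: "V p \<in> tangent_space A p"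
  using killing by (auto simp: killing_def vector_field_on_def)

private lemma eventually_in_chart: "\<forall>\<^sub>F s in at t within I. s \<in> I \<and> \<gamma> s \<in> cdom c"
  using smooth_curve_velocity(1)[OF curve t chart_at_mem mem_chart_at]
  by (auto simp: eventually_at_filter elim: eventually_mono)

private lemma has_vector_derivative_chart:
  "((\<lambda>s. cmap c (\<gamma> s)) has_vector_derivative y) (at t within I)"
  by (rule smooth_curve_velocity(2)[OF curve t chart_at_mem mem_chart_at])

private lemma has_vector_derivative_X:
  "((\<lambda>s. X (cmap c (\<gamma> s))) has_vector_derivative DX) (at t within I)"
  using vector_field_component_smooth[OF V_field chart_at_mem]
  by (rule has_vector_derivative_compose_frechet[OF _ _ has_vector_derivative_chart])
    (simp add: mem_chart_at)

private lemma X_eq: "\<gamma> s \<in> cdom c \<Longrightarrow> X (cmap c (\<gamma> s)) = V (\<gamma> s) c"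
  by (simp add: cinv_cmap chart_at_mem)

private lemma killing_along: "chart_dl c (x, y) (V (\<gamma> t) c, DX) = 0"
  by (rule killing_in_chart[OF killing lift[OF t] refl])

private lemma cov_component:
    "cov_deriv A nabla I \<gamma> Z t c = vector_derivative (\<lambda>s. Z s c) (at t within I)
      + christoffel_map c (\<gamma> t, velocity A I \<gamma> t) y (Z t c)"
  and cov_tangent: "cov_deriv A nabla I \<gamma> Z t \<in> tangent_space A (\<gamma> t)"
  using cov_deriv_component[of I \<gamma> t c] lift[OF t] by (simp_all add: lift_def)

text \<open>By \<open>chart_dl_christoffel\<close> the Christoffel term contributes the base
  derivative of the Lagrangian along \<open>V\<close>, which completes the fibre term to the
  infinitesimal Killing equation.\<close>

lemma momentum_cov_deriv_killing: "momentum A L I \<gamma> (cov_deriv A nabla I \<gamma> (\<lambda>s. V (\<gamma> s))) t = 0"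
proof -
  interpret F: conic_lagrangian "chart_dom c" "chart_lagrangian c"
    by (rule conic_lagrangian_chart[OF chart_at_mem])
  let ?w = "V (\<gamma> t) c"
  have lin: "linear (chart_dl c (x, y))"
    by (rule F.linear_dl[OF chart_dom_memI[OF lift[OF t] mem_chart_at]])
  have "((\<lambda>s. V (\<gamma> s) c) has_vector_derivative DX) (at t within I)"
    using has_vector_derivative_X unfolding has_vector_derivative_def
    by (rule has_derivative_transform_eventually)
      (use eventually_in_chart t X_eq mem_chart_at in \<open>auto elim!: eventually_mono\<close>)
  then have "vector_derivative (\<lambda>s. V (\<gamma> s) c) (at t within I) = DX"
    by (rule vector_derivative_within[OF smooth_curve_at_neq_bot[OF curve t]])
  then have "cov_deriv A nabla I \<gamma> (\<lambda>s. V (\<gamma> s)) t c =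
      DX + christoffel_map c (\<gamma> t, velocity A I \<gamma> t) y ?w"
    by (simp add: cov_component)
  moreover have "chart_dl c (x, y) (0, DX + christoffel_map c (\<gamma> t, velocity A I \<gamma> t) y ?w) =
      chart_dl c (x, y) (0, DX) + chart_dl c (x, y) (?w, 0)"
    using linear_add[OF lin, of "(0, DX)" "(0, christoffel_map c (\<gamma> t, velocity A I \<gamma> t) y ?w)"]
      chart_dl_christoffel[OF lift[OF t] refl refl, of ?w] by simp
  moreover have "chart_dl c (x, y) (0, DX) + chart_dl c (x, y) (?w, 0) = 0"
    using killing_along linear_add[OF lin, of "(0, DX)" "(?w, 0)"] by simp
  ultimately show ?thesis
    using fund_tensor_velocity_left[OF lift[OF t] cov_tangent[of "\<lambda>s. V (\<gamma> s)"] chart_at_mem mem_chart_at]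
    by (simp add: momentum_def lift_def)
qed

text \<open>Vanishing work amounts to the Euler-Lagrange equation tested on \<open>V\<close> alone.
  Inserted into the product rule for the momentum, it leaves the left side of the Killing
  equation.\<close>

lemma momentum_killing_has_vector_derivative:
  assumes work: "work A L nabla I \<gamma> (\<lambda>s. V (\<gamma> s)) t = 0"
  shows "((\<lambda>t. momentum A L I \<gamma> (\<lambda>s. V (\<gamma> s)) t) has_vector_derivative 0) (at t within I)"
proof -
  interpret F: conic_lagrangian "chart_dom c" "chart_lagrangian c"
    by (rule conic_lagrangian_chart[OF chart_at_mem])
  let ?v = "(\<gamma> t, velocity A I \<gamma> t)" and ?w = "V (\<gamma> t) c"
  let ?Y = "\<lambda>s. velocity A I \<gamma> s c"
  let ?q = "chart_ddl c (x, y) ?w"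
  define Y' where "Y' = vector_derivative ?Y (at t within I)"
  have dom: "(x, y) \<in> chart_dom c"
    by (rule chart_dom_memI[OF lift[OF t] mem_chart_at])
  note lin = F.linear_dl[OF dom] F.linear_ddl[OF dom, of ?w]
  have Y': "(?Y has_vector_derivative Y') (at t within I)"
    unfolding Y'_def vector_derivative_works[symmetric]
    by (rule smooth_curve_velocity(3)[OF curve t chart_at_mem mem_chart_at])
  have "?q (0, Y' + christoffel_map c ?v y y) = 0"
    using fund_tensor_eq[OF lift[OF t] cov_tangent[of "velocity A I \<gamma>"] V_tangent chart_at_mem mem_chart_at]
      cov_component[of "velocity A I \<gamma>"] work
    by (simp add: work_def lift_def Y'_def)
  then have "?q (0, Y') = - ?q (0, christoffel_map c ?v y y)"
    using linear_add[OF lin(2), of "(0, Y')" "(0, christoffel_map c ?v y y)"] by simp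
  moreover have "?q (y, 0) = ?q (0, christoffel_map c ?v y y) + chart_dl c (x, y) (?w, 0)"
    using metric_compatible_in_chart[OF lift[OF t] refl refl, of ?w y]
      chart_dl_christoffel[OF lift[OF t] refl refl, of ?w] by simp
  \<comment> \<open>The quadratic term \<open>christoffel_map c ?v y y\<close> from the acceleration
    cancels the one from metric compatibility.\<close>
  ultimately have euler_lagrange: "?q (y, Y') = chart_dl c (x, y) (?w, 0)"
    using linear_add[OF lin(2), of "(y, 0)" "(0, Y')"] by simp
  have z: "((\<lambda>s. (cmap c (\<gamma> s), ?Y s)) has_vector_derivative (y, Y')) (at t within I)"
    by (rule has_vector_derivative_Pair[OF has_vector_derivative_chart Y'])
  have k: "((\<lambda>s. (0::'e, X (cmap c (\<gamma> s)))) has_vector_derivative (0, DX)) (at t within I)"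
    by (rule has_vector_derivative_Pair[OF has_vector_derivative_const has_vector_derivative_X])
  have "((\<lambda>s. chart_dl c (cmap c (\<gamma> s), ?Y s) (0, X (cmap c (\<gamma> s)))) has_vector_derivative
      ?q (y, Y') + chart_dl c (x, y) (0, DX)) (at t within I)"
    using has_vector_derivative_frechet_derivative_apply[OF F.open_dom F.smooth _ t z k] dom
      X_eq[OF mem_chart_at] by simp
  moreover have "?q (y, Y') + chart_dl c (x, y) (0, DX) = 0"
    using killing_along euler_lagrange linear_add[OF lin(1), of "(?w, 0)" "(0, DX)"] by simp
  ultimately have "((\<lambda>s. chart_dl c (cmap c (\<gamma> s), ?Y s) (0, X (cmap c (\<gamma> s)))) has_vector_derivative 0)
      (at t within I)" by simp
  from has_vector_derivative_mult_right[OF this, of "1/2"]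
  have D: "((\<lambda>s. 1/2 * chart_dl c (cmap c (\<gamma> s), ?Y s) (0, X (cmap c (\<gamma> s)))) has_derivative (\<lambda>h. h *\<^sub>R 0))
      (at t within I)" by (simp add: has_vector_derivative_def)
  have mom: "1/2 * chart_dl c (cmap c (\<gamma> s), ?Y s) (0, X (cmap c (\<gamma> s))) =
      momentum A L I \<gamma> (\<lambda>s. V (\<gamma> s)) s" if "s \<in> I \<and> \<gamma> s \<in> cdom c" for s
    using fund_tensor_velocity_left[OF lift V_tangent chart_at_mem, of s "\<gamma> t"] that X_eq[of s]
    by (simp add: momentum_def lift_def)
  show ?thesis
    unfolding has_vector_derivative_def
    by (rule has_derivative_transform_eventually[OF D eventually_mono[OF eventually_in_chart mom] mom])
      (use t mem_chart_at in auto)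
qed

end

end

theorem theorem4p6:
  fixes A :: "('m::{t2_space, second_countable_topology}, 'e::euclidean_space) chart set"
    and U :: "('m \<times> ('m, 'e) tvec) set"
    and L :: "'m \<times> ('m, 'e) tvec \<Rightarrow> real"
    and nabla :: "('m, 'e) aniso_conn"
    and \<phi> :: "'m \<Rightarrow> real"
    and I :: "real set"
    and \<gamma> :: "real \<Rightarrow> 'm"
    and V :: "'m \<Rightarrow> ('m, 'e) tvec"
  assumes "smooth_atlas A"
    and "conic_pseudo_finsler A U L"
    and "chern_connection A U L nabla"
    and "smooth_fun_on A UNIV \<phi>"
    and "motion A U nabla (conservative_force A L \<phi>) I \<gamma>"
    and "vector_field_on A UNIV V"
    and "killing A U L V"
    and "\<forall>t\<in>I. work A L nabla I \<gamma> (\<lambda>s. V (\<gamma> s)) t = 0"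
  shows "(\<lambda>t. momentum A L I \<gamma> (\<lambda>s. V (\<gamma> s)) t) constant_on I
    \<and> (\<forall>t\<in>I. momentum A L I \<gamma> (cov_deriv A nabla I \<gamma> (\<lambda>s. V (\<gamma> s))) t = 0)"
proof -
  interpret chern_manifold A U L nabla
    by unfold_locales (fact assms)+
  have admissible: "admissible_curve A U I \<gamma>"
    using assms(5) by (simp add: motion_def)
  then have "convex I"
    by (simp add: admissible_curve_def smooth_curve_def is_interval_convex)
  \<comment> \<open>On a convex set of times a vanishing derivative within \<open>I\<close> forces
    constancy, end points included.\<close>
  then obtain k where "\<And>t. t \<in> I \<Longrightarrow> momentum A L I \<gamma> (\<lambda>s. V (\<gamma> s)) t = k"
    using has_vector_derivative_zero_constant momentum_killing_has_vector_derivative[OF assms(7) admissible]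
      assms(8) by blast
  then show ?thesis
    using momentum_cov_deriv_killing[OF assms(7) admissible] unfolding constant_on_def by blast
qed

end
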